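(* For every $n \geq 1$, $\mathsf{RT}^n_{<\infty, 2^{n-1}}$ admits strong cone avoidance for non-arithmetical cones: for every set $Z$, every set $A$ which is not arithmetical in $Z$, every $k\in\omega$ and every coloring $f : [\omega]^n \to k$, there is an infinite set $G$ with $|f[G]^n| \leq 2^{n-1}$ such that $A \not\leq_T G \oplus Z$.
   Context: $[\omega]^n$ denotes the set of $n$-element subsets of $\omega$. A set $A$ is arithmetical in $Z$ if $A \leq_T Z^{(j)}$ for some $j \in \omega$. *)

theory Defs
  imports "HOL-Library.Ramsey" "HOL-Library.Nat_Bijection"
begin

text \<open>
  Kleene's partial recursive functions relative to a set.  Programs are applied to argument lists of
  any length: \<open>Zero\<close> is constant at every arity, and a list too short for a program (or not of
  length one, for \<open>Succ\<close> and \<open>Oracle\<close>) makes it diverge.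
  In \<open>Pr\<close> the recursion variable, and in \<open>Mn\<close> the search variable, is the first argument.
\<close>

datatype recf =
    Zero
  | Succ
  | Proj nat
  | Oracle
  | Cn recf "recf list"
  | Pr recf recf
  | Mn recf

inductive computes :: "nat set \<Rightarrow> recf \<Rightarrow> nat list \<Rightarrow> nat \<Rightarrow> bool" for Z :: "nat set" where
  zero: "computes Z Zero xs 0"
| succ: "computes Z Succ [x] (Suc x)"
| proj: "i < length xs \<Longrightarrow> computes Z (Proj i) xs (xs ! i)"
| query: "computes Z Oracle [x] (if x \<in> Z then 1 else 0)"
| cn: "list_all2 (\<lambda>g y. computes Z g xs y) gs ys \<Longrightarrow> computes Z f ys z
    \<Longrightarrow> computes Z (Cn f gs) xs z"
| pr_0: "computes Z f xs y \<Longrightarrow> computes Z (Pr f g) (0 # xs) y"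
| pr_Suc: "computes Z (Pr f g) (n # xs) r \<Longrightarrow> computes Z g (n # r # xs) y
    \<Longrightarrow> computes Z (Pr f g) (Suc n # xs) y"
| mn: "computes Z f (n # xs) 0 \<Longrightarrow> (\<forall>m<n. \<exists>r. computes Z f (m # xs) (Suc r))
    \<Longrightarrow> computes Z (Mn f) xs n"

inductive_cases computes_cnE: "computes Z (Cn f gs) xs y"
inductive_cases computes_pr_0E: "computes Z (Pr f g) (0 # xs) y"
inductive_cases computes_pr_SucE: "computes Z (Pr f g) (Suc n # xs) y"
inductive_cases computes_mnE: "computes Z (Mn f) xs y"

lemma computes_deterministic:
  assumes "computes Z p xs y" and "computes Z p xs y'"
  shows "y = y'"
  using assms
proof (induction arbitrary: y' rule: computes.induct)
  case (cn xs gs ys f z)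
  from cn.prems obtain ys' where
    ys': "list_all2 (\<lambda>g y. computes Z g xs y) gs ys'" and z': "computes Z f ys' y'"
    by (rule computes_cnE)
  have "ys = ys'"
    using cn.IH(1) ys' unfolding list_all2_conv_all_nth
    by (intro nth_equalityI) auto
  with cn.IH(2) z' show ?case by blast
next
  case (pr_0 f xs y g)
  from pr_0.prems have "computes Z f xs y'" by (rule computes_pr_0E)
  with pr_0.IH show ?case by blast
next
  case (pr_Suc f g n xs r y)
  from pr_Suc.prems obtain r' where
    "computes Z (Pr f g) (n # xs) r'" and "computes Z g (n # r' # xs) y'"
    by (rule computes_pr_SucE)
  with pr_Suc.IH show ?case by blast
next
  case (mn f n xs)
  from mn.prems have 0: "computes Z f (y' # xs) 0"
    and less: "\<forall>m<y'. \<exists>r. computes Z f (m # xs) (Suc r)"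
    by (auto elim: computes_mnE)
  show ?case
  proof (rule linorder_cases[of n y'])
    assume "n < y'"
    with less obtain r where "computes Z f (n # xs) (Suc r)" by blast
    with mn.IH(1) have "0 = Suc r" by blast
    then show ?thesis by simp
  next
    assume "y' < n"
    with mn.IH(2) obtain r where "\<forall>v. computes Z f (y' # xs) v \<longrightarrow> Suc r = v" by blast
    with 0 have "Suc r = 0" by blast
    then show ?thesis by simp
  qed
qed (erule computes.cases; simp)+

definition turing_reducible :: "nat set \<Rightarrow> nat set \<Rightarrow> bool"  (infix "\<le>\<^sub>T" 50) where
  "A \<le>\<^sub>T B \<longleftrightarrow> (\<exists>p. \<forall>x. computes B p [x] (if x \<in> A then 1 else 0))"

text \<open>
  A Goedel numbering of programs; numbers outside its range index the nowhere defined function.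
\<close>

primrec recf_encode :: "recf \<Rightarrow> nat" where
  "recf_encode Zero = prod_encode (0, 0)"
| "recf_encode Succ = prod_encode (1, 0)"
| "recf_encode (Proj i) = prod_encode (2, i)"
| "recf_encode Oracle = prod_encode (3, 0)"
| "recf_encode (Cn f gs) =
     prod_encode (4, prod_encode (recf_encode f, list_encode (map recf_encode gs)))"
| "recf_encode (Pr f g) = prod_encode (5, prod_encode (recf_encode f, recf_encode g))"
| "recf_encode (Mn f) = prod_encode (6, recf_encode f)"

lemma recf_encode_inj: "recf_encode p = recf_encode q \<Longrightarrow> p = q"
proof (induction p arbitrary: q)
  case (Cn f gs)
  then show ?case
    by (cases q) (auto simp: list_encode_eq list_eq_iff_nth_eq dest: map_eq_imp_length_eq)
qed (case_tac q; auto)+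

definition turing_jump :: "nat set \<Rightarrow> nat set" where
  "turing_jump Z = {e. \<exists>p y. recf_encode p = e \<and> computes Z p [e] y}"

definition arithmetical_in :: "nat set \<Rightarrow> nat set \<Rightarrow> bool" where
  "arithmetical_in A Z \<longleftrightarrow> (\<exists>j. A \<le>\<^sub>T (turing_jump ^^ j) Z)"

definition turing_join :: "nat set \<Rightarrow> nat set \<Rightarrow> nat set"  (infixl "\<oplus>\<^sub>T" 65) where
  "A \<oplus>\<^sub>T B = (\<lambda>x. 2 * x) ` A \<union> (\<lambda>x. 2 * x + 1) ` B"

end

theory Submission
  imports Defs "HOL-Analysis.Function_Topology"
begin

text \<open>
  Let \<open>G\<close> be built from finite blocks, each homogeneous for all the colourings that matter; then the
  colour of an \<open>n\<close>-set depends only on the composition of \<open>n\<close> that records how the set meets the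
  successive blocks, and \<open>n\<close> has \<open>2 ^ (n - 1)\<close> compositions.

  The construction is Mathias forcing with reservoirs arithmetical in \<open>Z\<close>.  For a stem \<open>F\<close> and a
  program \<open>p\<close>, either every infinite arithmetical subset of the current reservoir contains a finite
  block \<open>E\<close> on whose subsets \<open>p\<close> gives contradictory answers, or the reservoir can be shrunk so that
  none does; in the latter case \<open>p\<close> cannot compute the nonarithmetical \<open>A\<close> from \<open>G\<close>.  In the former
  case blocks homogeneous for an arbitrary colouring exist as well: otherwise the least finite
  counterexamples form an arithmetical colouring, to which Ramsey's theorem applies within the
  arithmetical sets.  By compactness the colours of the blocks can be fixed once and for all, for all
  colourings and all programs simultaneously; applied to \<open>\<tau> \<mapsto> g (\<sigma> \<union> \<tau>)\<close> this yields a limit colour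
  for \<open>\<sigma>\<close>, and iterating gives one colour per composition.  The colouring \<open>f\<close> itself never enters the
  reservoirs, so it may be arbitrarily complicated.
\<close>

section \<open>Relative computability and the jump\<close>

lemma list_all2_common_bound:
  assumes "list_all2 (\<lambda>g y. \<exists>u. \<forall>v\<ge>u. Q v g y) gs ys"
  shows "\<exists>u::nat. \<forall>v\<ge>u. list_all2 (Q v) gs ys"
  using assms
proof (induction rule: list_all2_induct)
  case Nil
  then show ?case by simp
next
  case (Cons g gs y ys)
  then obtain u u' where "\<forall>v\<ge>u. Q v g y" and "\<forall>v\<ge>u'. list_all2 (Q v) gs ys" by blast
  then show ?case by (intro exI[of _ "max u u'"]) auto
qed

lemma common_bound_below:
  assumes "\<forall>m<n. \<exists>u. \<forall>v\<ge>u. Q v m"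
  shows "\<exists>u::nat. \<forall>v\<ge>u. \<forall>m<n::nat. Q v m"
  using assms
proof (induction n)
  case 0
  then show ?case by simp
next
  case (Suc n)
  then obtain u u' where "\<forall>v\<ge>u. Q v n" and "\<forall>v\<ge>u'. \<forall>m<n. Q v m" by (metis less_Suc_eq)
  then show ?case by (intro exI[of _ "max u u'"]) (auto simp: less_Suc_eq)
qed

definition agree_below :: "nat \<Rightarrow> nat set \<Rightarrow> nat set \<Rightarrow> bool" where
  "agree_below u V W \<longleftrightarrow> (\<forall>x<u. x \<in> V \<longleftrightarrow> x \<in> W)"

text \<open>A halting computation makes finitely many queries, so any bound above them works. The
  form "for all \<open>v \<ge> u\<close>" lets the bounds of subcomputations be merged by maxima:
  over the argument programs of \<open>Cn\<close> and over the smaller search values of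
  \<open>Mn\<close>.\<close>

lemma computes_use:
  assumes "computes W p xs y"
  shows "\<exists>u. \<forall>v\<ge>u. \<forall>V. agree_below v V W \<longrightarrow> computes V p xs y"
  using assms
proof (induction rule: computes.induct)
  case (query x)
  have "\<forall>v\<ge>Suc x. \<forall>V. agree_below v V W \<longrightarrow> computes V Oracle [x] (if x \<in> W then 1 else 0)"
  proof (intro allI impI)
    fix v V assume "Suc x \<le> v" "agree_below v V W"
    then have "x \<in> V \<longleftrightarrow> x \<in> W" by (auto simp: agree_below_def)
    with computes.query[of V x] show "computes V Oracle [x] (if x \<in> W then 1 else 0)" by simp
  qed
  then show ?case by blast
next
  case (cn xs gs ys f z)
  then have "list_all2 (\<lambda>g y. \<exists>u. \<forall>v\<ge>u. \<forall>V. agree_below v V W \<longrightarrow> computes V g xs y) gs ys"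
    by (auto elim: list_all2_mono)
  then obtain u where u: "\<forall>v\<ge>u. list_all2 (\<lambda>g y. \<forall>V. agree_below v V W \<longrightarrow> computes V g xs y) gs ys"
    using list_all2_common_bound[where Q = "\<lambda>v g y. \<forall>V. agree_below v V W \<longrightarrow> computes V g xs y"]
    by blast
  from cn obtain u' where u': "\<forall>v\<ge>u'. \<forall>V. agree_below v V W \<longrightarrow> computes V f ys z" by blast
  show ?case
  proof (intro exI[of _ "max u u'"] allI impI)
    fix v V assume v: "max u u' \<le> v" "agree_below v V W"
    then have "list_all2 (\<lambda>g y. computes V g xs y) gs ys"
      using u by (auto elim!: list_all2_mono)
    moreover have "computes V f ys z" using u' v by auto
    ultimately show "computes V (Cn f gs) xs z" by (rule computes.cn)
  qed
next
  case (pr_0 f xs y g)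
  then show ?case by (meson computes.pr_0)
next
  case (pr_Suc f g n xs r y)
  then obtain u u' where "\<forall>v\<ge>u. \<forall>V. agree_below v V W \<longrightarrow> computes V (Pr f g) (n # xs) r"
    and "\<forall>v\<ge>u'. \<forall>V. agree_below v V W \<longrightarrow> computes V g (n # r # xs) y" by blast
  then show ?case by (intro exI[of _ "max u u'"] allI impI) (rule computes.pr_Suc[where r = r], auto)
next
  case (mn f n xs)
  then obtain u where u: "\<forall>v\<ge>u. \<forall>V. agree_below v V W \<longrightarrow> computes V f (n # xs) 0" by blast
  have "\<forall>m<n. \<exists>u. \<forall>v\<ge>u. \<exists>r. \<forall>V. agree_below v V W \<longrightarrow> computes V f (m # xs) (Suc r)"
    using mn by meson
  from common_bound_below[OF this] obtain u' where
    u': "\<forall>v\<ge>u'. \<forall>m<n. \<exists>r. \<forall>V. agree_below v V W \<longrightarrow> computes V f (m # xs) (Suc r)" by blast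
  show ?case
  proof (intro exI[of _ "max u u'"] allI impI)
    fix v V assume v: "max u u' \<le> v" "agree_below v V W"
    have "\<forall>m<n. \<exists>r. \<forall>V. agree_below v V W \<longrightarrow> computes V f (m # xs) (Suc r)"
      using u' v(1) by simp
    then have "\<forall>m<n. \<exists>r. computes V f (m # xs) (Suc r)" using v(2) by blast
    moreover have "computes V f (n # xs) 0" using u v by auto
    ultimately show "computes V (Mn f) xs n" by (intro computes.mn)
  qed
qed (auto intro: computes.intros)

section \<open>Replacing the oracle by a program\<close>

primrec substitute_oracle :: "recf \<Rightarrow> recf \<Rightarrow> recf" where
  "substitute_oracle q Zero = Zero"
| "substitute_oracle q Succ = Succ"
| "substitute_oracle q (Proj i) = Proj i"
| "substitute_oracle q Oracle = q"
| "substitute_oracle q (Cn f gs) = Cn (substitute_oracle q f) (map (substitute_oracle q) gs)"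
| "substitute_oracle q (Pr f g) = Pr (substitute_oracle q f) (substitute_oracle q g)"
| "substitute_oracle q (Mn f) = Mn (substitute_oracle q f)"

text \<open>Each query is answered by a run of \<open>q\<close>; this is the transitivity of Turing
  reducibility.\<close>

lemma computes_substitute_oracle:
  assumes q: "\<And>x. computes V q [x] (if x \<in> W then 1 else 0)"
    and "computes W p xs y"
  shows "computes V (substitute_oracle q p) xs y"
  using assms(2)
proof (induction rule: computes.induct)
  case (query x)
  show ?case using q[of x] by simp
next
  case (cn xs gs ys f z)
  then have "list_all2 (\<lambda>g y. computes V g xs y) (map (substitute_oracle q) gs) ys"
    by (auto simp: list_all2_map1 elim!: list_all2_mono)
  with cn show ?case by (auto intro: computes.cn)
next
  case (pr_Suc f g n xs r y)
  then show ?case by (auto intro: computes.pr_Suc)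
next
  case (mn f n xs)
  then show ?case by simp (meson computes.mn)
qed (auto intro: computes.intros)

section \<open>Programs for arithmetic and Cantor pairing\<close>

lemma computes_Cn1:
  "computes W g xs y \<Longrightarrow> computes W f [y] z \<Longrightarrow> computes W (Cn f [g]) xs z"
  by (rule computes.cn) auto

lemma computes_Cn2:
  "computes W g xs y \<Longrightarrow> computes W h xs y' \<Longrightarrow> computes W f [y, y'] z
    \<Longrightarrow> computes W (Cn f [g, h]) xs z"
  by (rule computes.cn) auto

lemma computes_Proj: "i < length xs \<Longrightarrow> y = xs ! i \<Longrightarrow> computes W (Proj i) xs y"
  by (simp add: computes.proj)

lemma computes_Pr:
  assumes "computes W f xs (h 0)"
    and "\<And>n. computes W g (n # h n # xs) (h (Suc n))"
  shows "computes W (Pr f g) (n # xs) (h n)"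
  by (induction n) (auto intro: assms computes.pr_0 computes.pr_Suc)

lemma computes_Mn_Least:
  assumes "\<And>m. computes W f (m # xs) (h m)" and "\<exists>m. h m = 0"
  shows "computes W (Mn f) xs (LEAST m. h m = 0)"
proof (rule computes.mn)
  show "computes W f ((LEAST m. h m = 0) # xs) 0"
    using assms(1)[of "LEAST m. h m = 0"] LeastI_ex[OF assms(2)] by simp
  show "\<forall>m<(LEAST m. h m = 0). \<exists>r. computes W f (m # xs) (Suc r)"
  proof (intro allI impI)
    fix m assume "m < (LEAST m. h m = 0)"
    then have "h m \<noteq> 0" by (rule not_less_Least)
    with assms(1)[of m] show "\<exists>r. computes W f (m # xs) (Suc r)" by (metis not0_implies_Suc)
  qed
qed

definition add_prog :: recf where
  "add_prog = Pr (Proj 0) (Cn Succ [Proj 1])"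

lemma computes_add: "computes W add_prog [x, y] (x + y)"
  unfolding add_prog_def
  by (rule computes_Pr) (auto intro!: computes_Proj computes_Cn1 computes.succ)

text \<open>The recursion variable comes first, so the subtrahend does too: on \<open>[x, y]\<close>
  the predecessor is applied \<open>x\<close> times to \<open>y\<close>.\<close>

definition monus_prog :: recf where
  "monus_prog = Pr (Proj 0) (Cn (Pr Zero (Proj 0)) [Proj 1])"

lemma computes_pred: "computes W (Pr Zero (Proj 0)) [x] (x - 1)"
  by (rule computes_Pr) (auto intro!: computes_Proj computes.zero)

lemma computes_monus: "computes W monus_prog [x, y] (y - x)"
  unfolding monus_prog_def
  by (rule computes_Pr)
    (auto intro!: computes_Proj computes_Cn1 computes_pred[THEN back_subst[where P = "computes W _ _"]])

definition triangle_prog :: recf where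
  "triangle_prog = Pr Zero (Cn add_prog [Proj 1, Cn Succ [Proj 0]])"

lemma computes_triangle: "computes W triangle_prog [x] (triangle x)"
  unfolding triangle_prog_def
proof (rule computes_Pr)
  show "computes W (Cn add_prog [Proj 1, Cn Succ [Proj 0]]) [n, triangle n] (triangle (Suc n))" for n
    unfolding triangle_Suc
    by (rule computes_Cn2[OF _ _ computes_add])
      (auto intro!: computes_Proj computes_Cn1 computes.succ simp del: triangle_Suc)
qed (simp add: computes.zero)

definition pair_prog :: recf where
  "pair_prog = Cn add_prog [Cn triangle_prog [add_prog], Proj 0]"

lemma computes_pair: "computes W pair_prog [x, y] (prod_encode (x, y))"
  unfolding pair_prog_def prod_encode_def split
  by (rule computes_Cn2[OF _ _ computes_add])
    (auto intro!: computes_Proj computes_Cn1 computes_add computes_triangle)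

definition pfst :: "nat \<Rightarrow> nat" where "pfst z = fst (prod_decode z)"
definition psnd :: "nat \<Rightarrow> nat" where "psnd z = snd (prod_decode z)"

lemma pfst_prod_encode [simp]: "pfst (prod_encode (x, y)) = x"
  and psnd_prod_encode [simp]: "psnd (prod_encode (x, y)) = y"
  by (simp_all add: pfst_def psnd_def)

lemma prod_encode_pfst_psnd [simp]: "prod_encode (pfst z, psnd z) = z"
  by (simp add: pfst_def psnd_def)

lemma mono_triangle: "m \<le> n \<Longrightarrow> triangle m \<le> triangle n"
  by (induction rule: dec_induct) auto

text \<open>Cantor's pairing puts \<open>z\<close> on the diagonal
  \<open>d = pfst z + psnd z\<close>, at \<open>triangle d + pfst z\<close>. The truncated
  difference vanishes exactly when \<open>z < triangle (Suc d)\<close>, so the search stops at the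
  first diagonal ending beyond \<open>z\<close>.\<close>

lemma Least_triangle: "(LEAST d. Suc z - triangle (Suc d) = 0) = pfst z + psnd z"
proof (rule Least_equality)
  have z: "z = triangle (pfst z + psnd z) + pfst z"
    using prod_encode_pfst_psnd[of z] unfolding prod_encode_def by simp
  then show "Suc z - triangle (Suc (pfst z + psnd z)) = 0" by simp
  fix d assume d: "Suc z - triangle (Suc d) = 0"
  show "pfst z + psnd z \<le> d"
  proof (rule ccontr)
    assume "\<not> pfst z + psnd z \<le> d"
    then have "triangle (Suc d) \<le> triangle (pfst z + psnd z)" by (intro mono_triangle) simp
    with z d show False by linarith
  qed
qed

definition diag_prog :: recf where
  "diag_prog = Mn (Cn monus_prog [Cn triangle_prog [Cn Succ [Proj 0]], Cn Succ [Proj 1]])"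

lemma computes_diag: "computes W diag_prog [z] (pfst z + psnd z)"
  unfolding diag_prog_def Least_triangle[symmetric]
proof (rule computes_Mn_Least)
  show "computes W (Cn monus_prog [Cn triangle_prog [Cn Succ [Proj 0]], Cn Succ [Proj 1]]) [d, z]
    (Suc z - triangle (Suc d))" for d
    by (rule computes_Cn2[OF _ _ computes_monus])
      (auto intro!: computes_Proj computes_Cn1 computes.succ computes_triangle simp del: triangle_Suc)
  show "\<exists>d. Suc z - triangle (Suc d) = 0"
  proof
    have "z = triangle (pfst z + psnd z) + pfst z"
      using prod_encode_pfst_psnd[of z] unfolding prod_encode_def by simp
    then show "Suc z - triangle (Suc (pfst z + psnd z)) = 0" by simp
  qed
qed

definition pfst_prog :: recf where
  "pfst_prog = Cn monus_prog [Cn triangle_prog [diag_prog], Proj 0]"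

lemma computes_pfst: "computes W pfst_prog [z] (pfst z)"
proof -
  have "z - triangle (pfst z + psnd z) = pfst z"
    using prod_encode_pfst_psnd[of z] unfolding prod_encode_def by simp
  moreover have "computes W pfst_prog [z] (z - triangle (pfst z + psnd z))"
    unfolding pfst_prog_def
    by (rule computes_Cn2[OF _ _ computes_monus])
      (auto intro!: computes_Proj computes_Cn1 computes_diag computes_triangle)
  ultimately show ?thesis by simp
qed

definition psnd_prog :: recf where
  "psnd_prog = Cn monus_prog [pfst_prog, diag_prog]"

lemma computes_psnd: "computes W psnd_prog [z] (psnd z)"
proof -
  have "computes W psnd_prog [z] (pfst z + psnd z - pfst z)"
    unfolding psnd_prog_def
    by (rule computes_Cn2[OF computes_pfst computes_diag computes_monus])
  then show ?thesis by simp
qed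

section \<open>Closure properties of unary computable functions\<close>

definition computable_in :: "nat set \<Rightarrow> (nat \<Rightarrow> nat) \<Rightarrow> bool" where
  "computable_in W f \<longleftrightarrow> (\<exists>p. \<forall>x. computes W p [x] (f x))"

lemma computable_in_subst:
  assumes "V \<le>\<^sub>T W" and "computable_in V f"
  shows "computable_in W f"
  using assms unfolding turing_reducible_def computable_in_def
  by (meson computes_substitute_oracle)

lemma computable_in_id: "computable_in W (\<lambda>x. x)"
  unfolding computable_in_def by (intro exI[of _ "Proj 0"]) (auto intro: computes_Proj)

lemma computable_in_const: "computable_in W (\<lambda>x. c)"
proof -
  have "\<exists>p. \<forall>xs. computes W p xs c"
    by (induction c) (auto intro: computes.zero computes_Cn1 computes.succ)
  then show ?thesis unfolding computable_in_def by blast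
qed

lemma computable_in_comp:
  "computable_in W h \<Longrightarrow> computable_in W f \<Longrightarrow> computable_in W (\<lambda>x. h (f x))"
  unfolding computable_in_def by (meson computes_Cn1)

lemma computable_in_Suc: "computable_in W Suc"
  unfolding computable_in_def by (meson computes.succ)

lemma computable_in_pfst: "computable_in W pfst"
  unfolding computable_in_def by (meson computes_pfst)

lemma computable_in_psnd: "computable_in W psnd"
  unfolding computable_in_def by (meson computes_psnd)

lemma computable_in_pair:
  "computable_in W f \<Longrightarrow> computable_in W g \<Longrightarrow> computable_in W (\<lambda>x. prod_encode (f x, g x))"
  unfolding computable_in_def by (meson computes_Cn2 computes_pair)

lemma computable_in_rec:
  assumes "computable_in W a" and "computable_in W b" and "computable_in W m"
  shows "computable_in W
    (\<lambda>x. rec_nat (a x) (\<lambda>n r. b (prod_encode (prod_encode (n, r), x))) (m x))"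
proof -
  from assms obtain pa pb pm where a: "\<And>x. computes W pa [x] (a x)"
    and b: "\<And>x. computes W pb [x] (b x)" and m: "\<And>x. computes W pm [x] (m x)"
    unfolding computable_in_def by blast
  have b': "computes W (Cn pb [Cn pair_prog [Cn pair_prog [Proj 0, Proj 1], Proj 2]])
      [n, r, x] (b (prod_encode (prod_encode (n, r), x)))" for n r x
    by (rule computes_Cn1[OF _ b])
      (auto intro!: computes_Cn2 computes_pair computes_Proj)
  have "computes W (Pr pa (Cn pb [Cn pair_prog [Cn pair_prog [Proj 0, Proj 1], Proj 2]])) [n, x]
      (rec_nat (a x) (\<lambda>n r. b (prod_encode (prod_encode (n, r), x))) n)" for n x
    by (rule computes_Pr) (simp_all add: a b'[simplified])
  note * = this
  have "computes W (Cn (Pr pa (Cn pb [Cn pair_prog [Cn pair_prog [Proj 0, Proj 1], Proj 2]]))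
      [pm, Proj 0]) [x] (rec_nat (a x) (\<lambda>n r. b (prod_encode (prod_encode (n, r), x))) (m x))" for x
    by (rule computes_Cn2[OF m _ *]) (simp add: computes_Proj)
  then show ?thesis unfolding computable_in_def by blast
qed

lemma computable_in_Least:
  assumes "computable_in W (\<lambda>z. h (pfst z) (psnd z))" and "\<And>x. \<exists>y. h x y = 0"
  shows "computable_in W (\<lambda>x. LEAST y. h x y = 0)"
proof -
  from assms(1) obtain p where p: "\<And>z. computes W p [z] (h (pfst z) (psnd z))"
    unfolding computable_in_def by blast
  \<comment> \<open>\<open>Mn\<close> passes the search variable first, hence the swapped
    projections.\<close>
  have "computes W (Cn p [Cn pair_prog [Proj 1, Proj 0]]) [y, x] (h x y)" for x y
    using p[of "prod_encode (x, y)"]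
    by (auto intro!: computes_Cn1[of _ _ _ "prod_encode (x, y)"] computes_Cn2[OF _ _ computes_pair]
        computes_Proj)
  then show ?thesis
    unfolding computable_in_def
    using computes_Mn_Least[where W = W and h = "h x" for x, OF _ assms(2)] by blast
qed

text \<open>The argument \<open>x\<close> is built into the program, which ignores its input; so membership of its code in
  the jump decides whether the search succeeds.\<close>

definition search_prog :: "recf \<Rightarrow> nat \<Rightarrow> recf" where
  "search_prog p x = Cn (Mn p) [((\<lambda>c. Cn Succ [c]) ^^ x) Zero]"

lemma computes_numeral: "computes W (((\<lambda>c. Cn Succ [c]) ^^ x) Zero) xs y \<longleftrightarrow> y = x"
proof -
  have "computes W (((\<lambda>c. Cn Succ [c]) ^^ x) Zero) xs x"
    by (induction x) (auto intro: computes.zero computes_Cn1 computes.succ)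
  then show ?thesis by (metis computes_deterministic)
qed

text \<open>As \<open>h\<close> is total, the search diverges only when there is no zero. The input
  \<open>xs\<close> is arbitrary, so it may be the program's own code, which is how the jump runs
  it.\<close>

lemma search_prog_halts:
  assumes "\<And>x y. computes W p [y, x] (h x y)"
  shows "(\<exists>z. computes W (search_prog p x) xs z) \<longleftrightarrow> (\<exists>y. h x y = 0)"
proof
  assume "\<exists>z. computes W (search_prog p x) xs z"
  then obtain z where "computes W (search_prog p x) xs z" ..
  then have "computes W (Mn p) [x] z"
    unfolding search_prog_def by (auto elim!: computes_cnE simp: computes_numeral list_all2_Cons1)
  then have "computes W p [z, x] 0" by (auto elim: computes_mnE)
  with assms have "h x z = 0" by (metis computes_deterministic)
  then show "\<exists>y. h x y = 0" ..
next
  assume "\<exists>y. h x y = 0"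
  with computes_Mn_Least[where f = p and xs = "[x]" and h = "h x"] assms
  have "computes W (Mn p) [x] (LEAST y. h x y = 0)" by blast
  then show "\<exists>z. computes W (search_prog p x) xs z"
    unfolding search_prog_def using computes_Cn1 computes_numeral by blast
qed

text \<open>Presents the code as a function of \<open>x\<close> built from pairing and primitive
  recursion, from which its computability is read off; \<open>Suc (prod_encode (r, 0))\<close> codes
  the list \<open>[r]\<close>.\<close>

lemma recf_encode_search_prog:
  "recf_encode (search_prog p x) =
    prod_encode (4, prod_encode (prod_encode (6, recf_encode p), Suc (prod_encode
      (rec_nat (recf_encode Zero)
        (\<lambda>_ r. prod_encode (4, prod_encode (prod_encode (1, 0), Suc (prod_encode (r, 0))))) x, 0))))"
proof -
  have "recf_encode (((\<lambda>c. Cn Succ [c]) ^^ x) Zero) = rec_nat (recf_encode Zero)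
      (\<lambda>_ r. prod_encode (4, prod_encode (prod_encode (1, 0), Suc (prod_encode (r, 0))))) x"
    by (induction x) auto
  then show ?thesis by (simp add: search_prog_def)
qed

lemma computable_in_recf_encode_search_prog:
  "computable_in W (\<lambda>x. recf_encode (search_prog p x))"
proof -
  have "computable_in W (\<lambda>x. rec_nat (recf_encode Zero)
        (\<lambda>n r. (\<lambda>z. prod_encode (4, prod_encode (prod_encode (1, 0),
          Suc (prod_encode (psnd (pfst z), 0))))) (prod_encode (prod_encode (n, r), x))) x)"
    by (intro computable_in_rec computable_in_pair computable_in_const computable_in_id
        computable_in_comp[OF computable_in_Suc] computable_in_comp[OF computable_in_psnd]
        computable_in_pfst)
  then show ?thesis
    unfolding recf_encode_search_prog
    by (intro computable_in_pair computable_in_const computable_in_comp[OF computable_in_Suc]) simp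
qed

section \<open>Existential quantifiers and the jump\<close>

lemma computable_in_indicator:
  "computable_in W (\<lambda>x. if x \<in> W then 1 else 0)"
  unfolding computable_in_def by (meson computes.query)

text \<open>One quantifier costs one jump: the code of the search program is computable from
  \<open>x\<close>, and it lies in the jump iff the search succeeds.\<close>

lemma computable_in_jump_ex:
  assumes "computable_in W (\<lambda>z. h (pfst z) (psnd z))"
  shows "computable_in (turing_jump W) (\<lambda>x. if \<exists>y. h x y = 0 then 1 else 0)"
proof -
  from assms obtain p where p: "\<And>z. computes W p [z] (h (pfst z) (psnd z))"
    unfolding computable_in_def by blast
  define q where "q = Cn p [Cn pair_prog [Proj 1, Proj 0]]"
  have q: "computes W q [y, x] (h x y)" for x y
    unfolding q_def using p[of "prod_encode (x, y)"]
    by (auto intro!: computes_Cn1[of _ _ _ "prod_encode (x, y)"] computes_Cn2[OF _ _ computes_pair]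
        computes_Proj)
  have "recf_encode (search_prog q x) \<in> turing_jump W \<longleftrightarrow> (\<exists>y. h x y = 0)" for x
    unfolding turing_jump_def search_prog_halts[OF q, of x "[recf_encode (search_prog q x)]", symmetric]
    by (auto dest!: recf_encode_inj)
  moreover from computable_in_comp[OF computable_in_indicator computable_in_recf_encode_search_prog]
  have "computable_in (turing_jump W)
      (\<lambda>x. if recf_encode (search_prog q x) \<in> turing_jump W then 1 else 0)" by blast
  ultimately show ?thesis by simp
qed

lemma computable_in_jump:
  assumes "computable_in W f"
  shows "computable_in (turing_jump W) f"
proof (rule computable_in_subst[OF _ assms])
  \<comment> \<open>Membership in \<open>W\<close> becomes an existential statement with a dummy
    variable, so that \<open>computable_in_jump_ex\<close> applies. The recursion flips the
    indicator, because there a zero stands for truth.\<close>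
  have "computable_in W (\<lambda>z. rec_nat 1 (\<lambda>_ _. 0) (if pfst z \<in> W then 1 else 0))"
    by (rule computable_in_rec[where a = "\<lambda>_. 1" and b = "\<lambda>_. 0"])
      (intro computable_in_const computable_in_comp[OF computable_in_indicator] computable_in_pfst)+
  then have "computable_in W (\<lambda>z. (\<lambda>x y. if x \<in> W then 0 else 1) (pfst z) (psnd z))"
    by (rule back_subst[of "computable_in W"]) auto
  from computable_in_jump_ex[OF this]
  have "computable_in (turing_jump W) (\<lambda>x. if x \<in> W then 1 else 0)"
    by (rule back_subst[of "computable_in (turing_jump W)"]) auto
  then show "W \<le>\<^sub>T turing_jump W" unfolding turing_reducible_def computable_in_def .
qed

section \<open>Functions arithmetical in a set\<close>

text \<open>The number of jumps stays existentially quantified, as every quantifier in a definition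
  may add one.\<close>

definition arith_fun :: "nat set \<Rightarrow> (nat \<Rightarrow> nat) \<Rightarrow> bool" where
  "arith_fun Z f \<longleftrightarrow> (\<exists>j. computable_in ((turing_jump ^^ j) Z) f)"

definition arith_pred :: "nat set \<Rightarrow> (nat \<Rightarrow> bool) \<Rightarrow> bool" where
  "arith_pred Z P \<longleftrightarrow> arith_fun Z (\<lambda>x. if P x then 1 else 0)"

lemma arithmetical_in_iff: "arithmetical_in A Z \<longleftrightarrow> arith_pred Z (\<lambda>x. x \<in> A)"
  unfolding arithmetical_in_def arith_pred_def arith_fun_def turing_reducible_def computable_in_def ..

lemma computable_in_jumps:
  "computable_in ((turing_jump ^^ i) Z) f \<Longrightarrow> i \<le> j \<Longrightarrow> computable_in ((turing_jump ^^ j) Z) f"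
proof (induction j)
  case (Suc j)
  then show ?case by (cases "i = Suc j") (auto intro: computable_in_jump)
qed simp

text \<open>Turns the search for a zero into the search for a witness, by way of the indicator of
  the negation.\<close>

lemma indicator_eq_0: "(if \<not> b then 1 else 0 :: nat) = 0 \<longleftrightarrow> b"
  by simp

named_theorems arith_intros

section \<open>Closure rules following the shape of a formula\<close>

locale arithmetic_in =
  fixes Z :: "nat set"
begin

abbreviation "af \<equiv> arith_fun Z"
abbreviation "ap \<equiv> arith_pred Z"

lemma arith_fun_common:
  assumes "af f" and "af g"
  obtains j where "computable_in ((turing_jump ^^ j) Z) f" "computable_in ((turing_jump ^^ j) Z) g"
  using assms computable_in_jumps unfolding arith_fun_def
  by (metis max.cobounded1 max.cobounded2)

lemma arith_id [arith_intros]: "af (\<lambda>x. x)"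
  unfolding arith_fun_def using computable_in_id by blast

lemma arith_const [arith_intros]: "af (\<lambda>x. c)"
  unfolding arith_fun_def using computable_in_const by blast

lemma arith_comp: "af h \<Longrightarrow> af f \<Longrightarrow> af (\<lambda>x. h (f x))"
  unfolding arith_fun_def[of Z "\<lambda>x. h (f x)"]
  by (erule (1) arith_fun_common) (blast intro: computable_in_comp)

lemma arith_Suc [arith_intros]: "af f \<Longrightarrow> af (\<lambda>x. Suc (f x))"
  by (rule arith_comp[of Suc]) (unfold arith_fun_def, blast intro: computable_in_Suc)

lemma arith_pfst [arith_intros]: "af f \<Longrightarrow> af (\<lambda>x. pfst (f x))"
  by (rule arith_comp[of pfst]) (unfold arith_fun_def, blast intro: computable_in_pfst)

lemma arith_psnd [arith_intros]: "af f \<Longrightarrow> af (\<lambda>x. psnd (f x))"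
  by (rule arith_comp[of psnd]) (unfold arith_fun_def, blast intro: computable_in_psnd)

lemma arith_pair [arith_intros]: "af f \<Longrightarrow> af g \<Longrightarrow> af (\<lambda>x. prod_encode (f x, g x))"
  unfolding arith_fun_def[of Z "\<lambda>x. prod_encode (f x, g x)"]
  by (erule (1) arith_fun_common) (blast intro: computable_in_pair)

lemma arith_fun_comp2:
  assumes "af (\<lambda>z. h (pfst z) (psnd z))" and "af f" and "af g"
  shows "af (\<lambda>x. h (f x) (g x))"
  using arith_comp[OF assms(1) arith_pair[OF assms(2,3)]] by simp

lemma arith_rec [arith_intros]:
  assumes "af a" and "af (\<lambda>z. b (pfst (pfst z)) (psnd (pfst z)) (psnd z))" and "af m"
  shows "af (\<lambda>x. rec_nat (a x) (\<lambda>n r. b n r x) (m x))"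
proof -
  let ?b = "\<lambda>z. b (pfst (pfst z)) (psnd (pfst z)) (psnd z)"
  from assms obtain i j k where "computable_in ((turing_jump ^^ i) Z) a"
    "computable_in ((turing_jump ^^ j) Z) ?b" "computable_in ((turing_jump ^^ k) Z) m"
    unfolding arith_fun_def by blast
  then have "computable_in ((turing_jump ^^ max i (max j k)) Z) a"
    "computable_in ((turing_jump ^^ max i (max j k)) Z) ?b"
    "computable_in ((turing_jump ^^ max i (max j k)) Z) m"
    by (auto elim: computable_in_jumps)
  from computable_in_rec[OF this] show ?thesis unfolding arith_fun_def by auto
qed

lemma arith_pred_const [arith_intros]: "ap (\<lambda>x. c)"
  unfolding arith_pred_def by (rule arith_const)

lemma arith_pred_cong: 
  assumes "ap P" and "\<And>x. P x \<longleftrightarrow> Q x"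
  shows "ap Q"
proof -
  from assms(2) have "P = Q" by blast
  with assms(1) show ?thesis by simp
qed

lemma arith_pred_comp: "ap P \<Longrightarrow> af f \<Longrightarrow> ap (\<lambda>x. P (f x))"
  unfolding arith_pred_def by (rule arith_comp)

lemma arith_pred_comp2:
  assumes "ap (\<lambda>z. P (pfst z) (psnd z))" and "af f" and "af g"
  shows "ap (\<lambda>x. P (f x) (g x))"
  using arith_pred_comp[OF assms(1) arith_pair[OF assms(2,3)]] by simp

lemma arith_if [arith_intros]:
  assumes "ap P" and "af f" and "af g"
  shows "af (\<lambda>x. if P x then f x else g x)"
proof -
  \<comment> \<open>A recursion of length 0 or 1 acts as a case distinction.\<close>
  have "af (\<lambda>x. rec_nat (g x) (\<lambda>n r. f x) (if P x then 1 else 0))"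
    using assms unfolding arith_pred_def by (intro arith_intros arith_comp[OF \<open>af f\<close>])
  then show ?thesis by (rule back_subst[of af]) auto
qed

lemma arith_pred_If:
  assumes "ap P" and "ap Q" and "ap R"
  shows "ap (\<lambda>x. if P x then Q x else R x)"
proof -
  have "af (\<lambda>x. if P x then if Q x then 1 else 0 else if R x then 1 else 0)"
    using assms unfolding arith_pred_def
    by (intro arith_if arith_const) (simp_all add: arith_pred_def)
  then show ?thesis unfolding arith_pred_def by (rule back_subst[of af]) auto
qed

lemma arith_not [arith_intros]: "ap P \<Longrightarrow> ap (\<lambda>x. \<not> P x)"
  by (rule arith_pred_cong[OF arith_pred_If[of P "\<lambda>_. False" "\<lambda>_. True"]]) (auto intro: arith_pred_const)

lemma arith_conj [arith_intros]: "ap P \<Longrightarrow> ap Q \<Longrightarrow> ap (\<lambda>x. P x \<and> Q x)"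
  by (rule arith_pred_cong[OF arith_pred_If[of P Q "\<lambda>_. False"]]) (auto intro: arith_pred_const)

lemma arith_disj [arith_intros]: "ap P \<Longrightarrow> ap Q \<Longrightarrow> ap (\<lambda>x. P x \<or> Q x)"
  by (rule arith_pred_cong[OF arith_pred_If[of P "\<lambda>_. True" Q]]) (auto intro: arith_pred_const)

lemma arith_imp [arith_intros]: "ap P \<Longrightarrow> ap Q \<Longrightarrow> ap (\<lambda>x. P x \<longrightarrow> Q x)"
  by (rule arith_pred_cong[OF arith_pred_If[of P Q "\<lambda>_. True"]]) (auto intro: arith_pred_const)

lemma arith_iff [arith_intros]: "ap P \<Longrightarrow> ap Q \<Longrightarrow> ap (\<lambda>x. P x \<longleftrightarrow> Q x)"
  by (rule arith_pred_cong[OF arith_pred_If[of P Q "\<lambda>x. \<not> Q x"]]) (auto intro: arith_not)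

text \<open>Costs one more jump. Under the quantifier the parameter travels as \<open>pfst z\<close>
  and the bound variable as \<open>psnd z\<close>.\<close>

lemma arith_ex [arith_intros]:
  assumes "ap (\<lambda>z. P (pfst z) (psnd z))"
  shows "ap (\<lambda>x. \<exists>y. P x y)"
proof -
  have "ap (\<lambda>z. \<not> P (pfst z) (psnd z))" using assms by (rule arith_not)
  then obtain j where
    "computable_in ((turing_jump ^^ j) Z) (\<lambda>z. (\<lambda>x y. if \<not> P x y then 1 else 0) (pfst z) (psnd z))"
    unfolding arith_pred_def arith_fun_def by blast
  from computable_in_jump_ex[OF this]
  have "computable_in ((turing_jump ^^ Suc j) Z) (\<lambda>x. if \<exists>y. P x y then 1 else 0)"
    unfolding indicator_eq_0 by simp
  then show ?thesis unfolding arith_pred_def arith_fun_def by blast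
qed

lemma arith_all [arith_intros]:
  assumes "ap (\<lambda>z. P (pfst z) (psnd z))"
  shows "ap (\<lambda>x. \<forall>y. P x y)"
  using arith_not[OF arith_ex[of "\<lambda>x y. \<not> P x y"]] arith_not[OF assms] by simp

lemma arith_Least:
  assumes "ap (\<lambda>z. P (pfst z) (psnd z))" and "\<And>x. \<exists>y. P x y"
  shows "af (\<lambda>x. LEAST y. P x y)"
proof -
  have "ap (\<lambda>z. \<not> P (pfst z) (psnd z))" using assms(1) by (rule arith_not)
  then obtain j where
    "computable_in ((turing_jump ^^ j) Z) (\<lambda>z. (\<lambda>x y. if \<not> P x y then 1 else 0) (pfst z) (psnd z))"
    unfolding arith_pred_def arith_fun_def by blast
  from computable_in_Least[OF this] assms(2)
  have "computable_in ((turing_jump ^^ j) Z) (\<lambda>x. LEAST y. P x y)"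
    unfolding indicator_eq_0 by blast
  then show ?thesis unfolding arith_fun_def ..
qed

text \<open>The value \<open>h x\<close> is the least, and only, \<open>y\<close> on the graph above
  \<open>x\<close>.\<close>

lemma arith_fun_graph:
  assumes "ap (\<lambda>z. psnd z = h (pfst z))"
  shows "af h"
  using arith_Least[OF assms] by (simp add: Least_equality)

lemma arith_minus_one [arith_intros]: "af f \<Longrightarrow> af (\<lambda>x. f x - 1)"
proof -
  assume f: "af f"
  have "af (\<lambda>x. rec_nat 0 (\<lambda>n r. n) (f x))" by (intro arith_intros f)
  moreover have "rec_nat 0 (\<lambda>n r. n) y = y - 1" for y :: nat by (cases y) auto
  ultimately show ?thesis by simp
qed

lemma arith_diff [arith_intros]: "af f \<Longrightarrow> af g \<Longrightarrow> af (\<lambda>x. f x - g x)"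
proof -
  assume fg: "af f" "af g"
  have "af (\<lambda>x. rec_nat (f x) (\<lambda>n r. r - 1) (g x))" by (intro arith_intros fg)
  moreover have "rec_nat x (\<lambda>n r. r - 1) y = x - y" for x y :: nat by (induction y) auto
  ultimately show ?thesis by simp
qed

lemma arith_le [arith_intros]: "af f \<Longrightarrow> af g \<Longrightarrow> ap (\<lambda>x. f x \<le> g x)"
proof -
  assume "af f" "af g"
  then have "af (\<lambda>x. 1 - (f x - g x))" by (intro arith_intros)
  then show ?thesis unfolding arith_pred_def by (rule back_subst[of af]) auto
qed

lemma arith_less [arith_intros]: "af f \<Longrightarrow> af g \<Longrightarrow> ap (\<lambda>x. f x < g x)"
  unfolding Suc_le_eq[symmetric] by (intro arith_intros)

lemma arith_eq [arith_intros]: "af f \<Longrightarrow> af g \<Longrightarrow> ap (\<lambda>x. f x = g x)"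
  unfolding eq_iff by (intro arith_intros)

lemma arith_add [arith_intros]: "af f \<Longrightarrow> af g \<Longrightarrow> af (\<lambda>x. f x + g x)"
proof -
  assume fg: "af f" "af g"
  have "af (\<lambda>x. rec_nat (f x) (\<lambda>n r. Suc r) (g x))" by (intro arith_intros fg)
  moreover have "rec_nat x (\<lambda>n r. Suc r) y = x + y" for x y :: nat by (induction y) auto
  ultimately show ?thesis by simp
qed

lemma arith_mult [arith_intros]: "af f \<Longrightarrow> af g \<Longrightarrow> af (\<lambda>x. f x * g x)"
proof -
  assume fg: "af f" "af g"
  have "af (\<lambda>x. rec_nat 0 (\<lambda>n r. r + f x) (g x))" by (intro arith_intros fg arith_comp[OF \<open>af f\<close>])
  moreover have "rec_nat 0 (\<lambda>n r. r + x) y = x * y" for x y :: nat by (induction y) auto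
  ultimately show ?thesis by simp
qed

lemma arith_power2: "af f \<Longrightarrow> af (\<lambda>x. 2 ^ f x)"
proof -
  assume f: "af f"
  have "af (\<lambda>x. rec_nat (1::nat) (\<lambda>n r. r + r) (f x))" by (intro arith_intros f)
  moreover have "rec_nat 1 (\<lambda>n r. r + r) y = (2::nat) ^ y" for y by (induction y) auto
  ultimately show ?thesis by simp
qed

lemma arith_set_decode [arith_intros]:
  assumes "af f" and "af g"
  shows "ap (\<lambda>x. f x \<in> set_decode (g x))"
proof -
  \<comment> \<open>Bit \<open>y\<close> of \<open>u\<close> is odd, said without division, so that
    the rules for sums, products and powers apply.\<close>
  have *: "y \<in> set_decode u \<longleftrightarrow> (\<exists>q r. u = Suc (q + q) * 2 ^ y + r \<and> r < 2 ^ y)" for y u :: nat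
  proof
    assume "y \<in> set_decode u"
    then obtain q where "u div 2 ^ y = Suc (q + q)"
      unfolding set_decode_def by (auto elim!: oddE simp: mult_2)
    then have "u = Suc (q + q) * 2 ^ y + u mod 2 ^ y \<and> u mod 2 ^ y < 2 ^ y"
      using div_mult_mod_eq[of u "2 ^ y"] by simp
    then show "\<exists>q r. u = Suc (q + q) * 2 ^ y + r \<and> r < 2 ^ y" by blast
  next
    assume "\<exists>q r. u = Suc (q + q) * 2 ^ y + r \<and> r < 2 ^ y"
    then obtain q r where "u = Suc (q + q) * 2 ^ y + r" "r < 2 ^ y" by blast
    then have "u div 2 ^ y = Suc (q + q)" by (simp add: div_add1_eq)
    then show "y \<in> set_decode u" unfolding set_decode_def by simp
  qed
  show ?thesis unfolding * by (intro arith_intros arith_power2 arith_comp[OF assms(1)] arith_comp[OF assms(2)])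
qed

lemma arith_bex_finite:
  assumes "finite I" and "\<And>i. i \<in> I \<Longrightarrow> ap (P i)"
  shows "ap (\<lambda>x. \<exists>i\<in>I. P i x)"
  using assms by (induction I) (auto intro!: arith_intros)

lemma arith_set_encode:
  assumes "ap (\<lambda>z. psnd z \<in> S (pfst z))" and "\<And>x. finite (S x)"
  shows "af (\<lambda>x. set_encode (S x))"
proof (rule arith_fun_graph)
  have "y = set_encode (S x) \<longleftrightarrow> (\<forall>w. w \<in> set_decode y \<longleftrightarrow> w \<in> S x)" for x y
    using assms(2)[of x] by (metis finite_set_decode set_decode_inverse set_encode_inverse set_eqI)
  then show "ap (\<lambda>z. psnd z = set_encode (S (pfst z)))"
    by (simp, intro arith_intros arith_pred_comp2[OF assms(1), of "\<lambda>z. _ z" "\<lambda>z. _ z"])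
qed

end

section \<open>Arithmetical definability of computations\<close>

lemma list_decode_Cons_iff:
  "list_decode l = x # list_decode l' \<longleftrightarrow> l = Suc (prod_encode (x, l'))"
  by (metis list_decode_inverse list_encode.simps(2) list_encode_inverse)

lemma list_decode_Suc_prod_encode: "list_decode (Suc (prod_encode (x, l))) = x # list_decode l"
  by (simp add: list_decode_Cons_iff)

lemma list_decode_Nil_iff: "list_decode l = [] \<longleftrightarrow> l = 0"
  by (metis list_decode.simps(1) list_decode_inverse)

lemma ex_list_decode: "(\<exists>xs. P xs) \<longleftrightarrow> (\<exists>l. P (list_decode l))"
  by (metis list_encode_inverse)

lemma list_decode_eq_Cons_iff:
  "list_decode l = x # xs \<longleftrightarrow> (\<exists>l'. xs = list_decode l' \<and> l = Suc (prod_encode (x, l')))"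
  by (metis list_decode_Cons_iff list_encode_inverse)

text \<open>Makes a partial function total: \<open>0\<close> stands for divergence and
  \<open>Suc y\<close> for the value \<open>y\<close>. The least-witness form fits
  \<open>arith_Least\<close>.\<close>

definition value_of :: "nat set \<Rightarrow> recf \<Rightarrow> nat list \<Rightarrow> nat" where
  "value_of W p xs = (LEAST v. (\<exists>y. v = Suc y \<and> computes W p xs y)
     \<or> (v = 0 \<and> \<not> (\<exists>y. computes W p xs y)))"

lemma value_of_eq_Suc_iff: "value_of W p xs = Suc y \<longleftrightarrow> computes W p xs y"
proof (cases "\<exists>y. computes W p xs y")
  case True
  then obtain z where z: "computes W p xs z" ..
  then have "value_of W p xs = Suc z"
    unfolding value_of_def by (intro Least_equality) (auto dest: computes_deterministic)
  with z show ?thesis by (auto dest: computes_deterministic)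
next
  case False
  then have "value_of W p xs = 0"
    unfolding value_of_def by (intro Least_equality) auto
  with False show ?thesis by auto
qed

text \<open>On shifted values \<open>Pr\<close> becomes a total \<open>rec_nat\<close> in which
  \<open>0\<close>, once reached, persists; \<open>arith_rec\<close> can then be used.\<close>

lemma computes_Pr_iff:
  "computes W (Pr f g) (n # xs) y \<longleftrightarrow>
    rec_nat (value_of W f xs) (\<lambda>n r. if r = 0 then 0 else value_of W g (n # (r - 1) # xs)) n = Suc y"
proof (induction n arbitrary: y)
  case 0
  show ?case
    by (auto simp: value_of_eq_Suc_iff intro: computes.pr_0 elim: computes_pr_0E)
next
  case (Suc n)
  let ?r = "rec_nat (value_of W f xs) (\<lambda>n r. if r = 0 then 0 else value_of W g (n # (r - 1) # xs)) n"
  have "computes W (Pr f g) (Suc n # xs) y \<longleftrightarrow>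
      (\<exists>r. computes W (Pr f g) (n # xs) r \<and> computes W g (n # r # xs) y)"
    by (auto intro: computes.pr_Suc elim: computes_pr_SucE)
  also have "\<dots> \<longleftrightarrow> (\<exists>r. ?r = Suc r \<and> value_of W g (n # r # xs) = Suc y)"
    unfolding Suc.IH value_of_eq_Suc_iff ..
  also have "\<dots> \<longleftrightarrow> (if ?r = 0 then 0 else value_of W g (n # (?r - 1) # xs)) = Suc y"
    by (cases ?r) auto
  finally show ?case by simp
qed

context arithmetic_in
begin

lemma arith_mem [arith_intros]: "af f \<Longrightarrow> ap (\<lambda>x. f x \<in> Z)"
proof (rule arith_pred_comp[of "\<lambda>x. x \<in> Z"])
  show "ap (\<lambda>x. x \<in> Z)"
    unfolding arith_pred_def arith_fun_def
    using computable_in_indicator[of Z] by (intro exI[of _ 0]) simp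
qed


lemma arith_list_nth:
  "af l \<Longrightarrow> af y \<Longrightarrow> ap (\<lambda>z. i < length (list_decode (l z)) \<and> y z = list_decode (l z) ! i)"
proof (induction i arbitrary: l y)
  case 0
  have *: "0 < length (list_decode w) \<and> v = list_decode w ! 0 \<longleftrightarrow> (\<exists>w'. w = Suc (prod_encode (v, w')))"
    for w v
    by (cases "list_decode w") (auto simp: list_decode_Nil_iff list_decode_eq_Cons_iff)
  show ?case unfolding * by (intro arith_intros arith_comp[OF 0(1)] arith_comp[OF 0(2)])
next
  case (Suc i)
  have *: "Suc i < length (list_decode w) \<and> v = list_decode w ! Suc i \<longleftrightarrow>
      (\<exists>u w'. w = Suc (prod_encode (u, w')) \<and> i < length (list_decode w') \<and> v = list_decode w' ! i)"
    for w v
    by (cases "list_decode w") (auto simp: list_decode_Nil_iff list_decode_eq_Cons_iff)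
  show ?case unfolding *
    by (rule arith_ex, rule arith_ex, rule arith_conj, rule_tac [2] Suc.IH)
      (intro arith_intros arith_comp[OF Suc.prems(1)] arith_comp[OF Suc.prems(2)])+
qed

lemma arith_value_of:
  assumes "\<And>c l y. af c \<Longrightarrow> af l \<Longrightarrow> af y \<Longrightarrow> ap (\<lambda>z. computes (B (c z)) p (list_decode (l z)) (y z))"
    and "af c" and "af l"
  shows "af (\<lambda>z. value_of (B (c z)) p (list_decode (l z)))"
  unfolding value_of_def
proof (rule arith_Least)
  show "ap (\<lambda>z. (\<exists>y. psnd z = Suc y \<and> computes (B (c (pfst z))) p (list_decode (l (pfst z))) y)
     \<or> (psnd z = 0 \<and> \<not> (\<exists>y. computes (B (c (pfst z))) p (list_decode (l (pfst z))) y)))"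
    by (intro arith_intros assms(1) arith_comp[OF assms(2)] arith_comp[OF assms(3)])
qed (metis)

text \<open>The program is fixed, so the defining formula is built by induction on it and no
  universal machine is involved. The oracle varies with \<open>z\<close> because later formulas
  quantify over finite sets joined to \<open>Z\<close>.\<close>

lemma arith_computes:
  assumes B: "ap (\<lambda>z. pfst z \<in> B (psnd z))"
  shows "af c \<Longrightarrow> af l \<Longrightarrow> af y \<Longrightarrow> ap (\<lambda>z. computes (B (c z)) p (list_decode (l z)) (y z))"
proof (induction p arbitrary: c l y)
  case Zero
  have "computes W Zero xs v \<longleftrightarrow> v = 0" for W xs v
    by (auto intro: computes.zero elim: computes.cases)
  with Zero show ?case by (auto intro: arith_intros)
next
  case Succ
  have *: "computes W Succ (list_decode w) v \<longleftrightarrow> (\<exists>u. w = Suc (prod_encode (u, 0)) \<and> v = Suc u)" for W w v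
  proof -
    have "computes W Succ xs v \<longleftrightarrow> (\<exists>u. xs = [u] \<and> v = Suc u)" for xs
      by (auto intro: computes.succ elim: computes.cases)
    then show ?thesis using list_decode_Cons_iff[of w _ 0] by simp
  qed
  show ?case unfolding * by (intro arith_intros arith_comp[OF Succ(2)] arith_comp[OF Succ(3)])
next
  case (Proj i)
  have *: "computes W (Proj i) xs v \<longleftrightarrow> i < length xs \<and> v = xs ! i" for W xs v
    by (auto intro: computes.proj elim: computes.cases)
  show ?case unfolding * by (intro arith_list_nth Proj)
next
  case Oracle
  have *: "computes W Oracle (list_decode w) v \<longleftrightarrow>
      (\<exists>u. w = Suc (prod_encode (u, 0)) \<and> v = (if u \<in> W then 1 else 0))" for W w v
  proof -
    have "computes W Oracle xs v \<longleftrightarrow> (\<exists>u. xs = [u] \<and> v = (if u \<in> W then 1 else 0))" for xs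
    proof
      assume "computes W Oracle xs v"
      then show "\<exists>u. xs = [u] \<and> v = (if u \<in> W then 1 else 0)" by cases blast
    qed (use computes.query[of W] in blast)
    then show ?thesis using list_decode_Cons_iff[of w _ 0] by simp
  qed
  show ?case unfolding *
    by (intro arith_intros arith_pred_comp2[OF B] arith_comp[OF Oracle(1)] arith_comp[OF Oracle(2)]
        arith_comp[OF Oracle(3)])
next
  case (Cn f gs)
  \<comment> \<open>Nested induction along the argument programs. The outer hypothesis covers
    members of \<open>gs\<close>, hence the condition on \<open>hs\<close>.\<close>
  have gs: "ap (\<lambda>z. list_all2 (\<lambda>g y. computes (B (c z)) g (list_decode (l z)) y) hs (list_decode (w z)))"
    if "set hs \<subseteq> set gs" and "af c" "af l" "af w" for hs c l w
    using that
  proof (induction hs arbitrary: c l w)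
    case Nil
    then show ?case by (auto simp: list_decode_Nil_iff intro!: arith_intros)
  next
    case (Cons h hs)
    have *: "list_all2 P (h # hs) (list_decode u) \<longleftrightarrow>
        (\<exists>y u'. u = Suc (prod_encode (y, u')) \<and> P h y \<and> list_all2 P hs (list_decode u'))" for P u
      by (auto simp: list_all2_Cons1 list_decode_eq_Cons_iff)
    have h: "h \<in> set gs" using Cons.prems by simp
    have hs: "set hs \<subseteq> set gs" using Cons.prems by simp
    show ?case unfolding *
      by (intro arith_ex arith_conj Cn.IH(2)[OF h] Cons.IH[OF hs] arith_eq arith_Suc arith_pair
          arith_comp[OF Cons.prems(2)] arith_comp[OF Cons.prems(3)] arith_comp[OF Cons.prems(4)])
        (intro arith_intros)+
  qed
  have *: "computes W (Cn f gs) xs v \<longleftrightarrow>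
      (\<exists>w. list_all2 (\<lambda>g y. computes W g xs y) gs (list_decode w) \<and> computes W f (list_decode w) v)" for W xs v
    using ex_list_decode[of "\<lambda>ys. list_all2 (\<lambda>g y. computes W g xs y) gs ys \<and> computes W f ys v"]
    by (auto intro: computes.cn elim: computes_cnE)
  show ?case unfolding *
    by (intro arith_ex arith_conj gs subset_refl Cn.IH(1)
        arith_comp[OF Cn.prems(1)] arith_comp[OF Cn.prems(2)] arith_comp[OF Cn.prems(3)])
      (intro arith_intros)+
next
  case (Pr f g)
  let ?V = "\<lambda>W w n. rec_nat (value_of W f (list_decode w)) (\<lambda>n r. if r = 0 then 0
       else value_of W g (list_decode (Suc (prod_encode (n, Suc (prod_encode (r - 1, w))))))) n"
  have *: "computes W (Pr f g) (list_decode u) v \<longleftrightarrow>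
      (\<exists>n w. u = Suc (prod_encode (n, w)) \<and> ?V W w n = Suc v)" for W u v
  proof -
    have "computes W (Pr f g) (list_decode u) v \<longleftrightarrow>
        (\<exists>n w. u = Suc (prod_encode (n, w)) \<and> computes W (Pr f g) (n # list_decode w) v)"
      by (cases "list_decode u")
        (auto simp: list_decode_eq_Cons_iff list_decode_Nil_iff elim: computes.cases)
    then show ?thesis unfolding computes_Pr_iff list_decode_Suc_prod_encode .
  qed
  show ?case unfolding *
    by (intro arith_ex arith_conj arith_eq arith_rec arith_if arith_const arith_value_of[OF Pr.IH(1)]
        arith_value_of[OF Pr.IH(2)] arith_comp[OF Pr.prems(1)] arith_comp[OF Pr.prems(2)]
        arith_comp[OF Pr.prems(3)] arith_Suc)
      (auto intro!: arith_intros)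
next
  case (Mn f)
  have *: "computes W (Mn f) (list_decode w) v \<longleftrightarrow>
      computes W f (list_decode (Suc (prod_encode (v, w)))) 0
      \<and> (\<forall>m. m < v \<longrightarrow> (\<exists>r. computes W f (list_decode (Suc (prod_encode (m, w)))) (Suc r)))" for W w v
    by (auto intro: computes.mn elim: computes_mnE)
  show ?case unfolding *
    by (intro arith_ex arith_all arith_conj arith_imp arith_less Mn.IH
        arith_comp[OF Mn.prems(1)] arith_comp[OF Mn.prems(2)] arith_comp[OF Mn.prems(3)])
      (intro arith_intros arith_comp[OF Mn.prems(2)] arith_comp[OF Mn.prems(3)])+
qed

end

section \<open>Ramsey's theorem for arithmetical colourings\<close>

text \<open>The number \<open>u\<close> codes a finite set of pairs (code of a set, colour). The
  default \<open>K\<close> makes the colouring total, and the minimum makes it single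
  valued.\<close>

definition colour_of :: "nat \<Rightarrow> nat \<Rightarrow> nat \<Rightarrow> nat" where
  "colour_of K u s = (LEAST c. c = K \<or> prod_encode (s, c) \<in> set_decode u)"

lemma colour_of_le: "colour_of K u s \<le> K"
  unfolding colour_of_def by (rule Least_le) simp

lemma ex_colour_of:
  assumes "finite D" and "\<And>s. s \<in> D \<Longrightarrow> h s \<le> K"
  shows "\<exists>u. \<forall>s\<in>D. colour_of K u s = h s"
proof (intro exI ballI)
  fix s assume "s \<in> D"
  let ?u = "set_encode ((\<lambda>s. prod_encode (s, h s)) ` D)"
  have "set_decode ?u = (\<lambda>s. prod_encode (s, h s)) ` D"
    using assms(1) by simp
  then show "colour_of K ?u s = h s"
    unfolding colour_of_def using \<open>s \<in> D\<close> assms(2)[of s]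
    by (intro Least_equality) auto
qed

lemma nsets_Suc_decompose:
  fixes S :: "nat set"
  assumes "S \<in> nsets Y (Suc m)"
  obtains y T where "S = insert y T" "y \<in> Y" "T \<in> nsets Y m" "\<And>x. x \<in> T \<Longrightarrow> x < y"
proof
  have S: "finite S" "S \<noteq> {}" "S \<subseteq> Y" "card S = Suc m"
    using assms unfolding nsets_def by auto
  show "S = insert (Max S) (S - {Max S})" "Max S \<in> Y" using S Max_in[of S] by blast+
  show "S - {Max S} \<in> nsets Y m" using S Max_in[of S] unfolding nsets_def by auto
  show "x < Max S" if "x \<in> S - {Max S}" for x using S that by (simp add: order.strict_iff_order)
qed

context arithmetic_in
begin

lemma arith_colour_of [arith_intros]:
  assumes "af u" "af s"
  shows "af (\<lambda>z. colour_of K (u z) (s z))"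
proof -
  have "af (\<lambda>z. colour_of K (pfst z) (psnd z))"
    unfolding colour_of_def by (rule arith_Least) (intro arith_intros, blast)
  from arith_fun_comp2[OF this assms] show ?thesis .
qed

lemma arith_card:
  assumes "af w"
  shows "ap (\<lambda>z. card (set_decode (w z)) = m)"
  using assms
proof (induction m arbitrary: w)
  case 0
  have *: "card (set_decode u) = 0 \<longleftrightarrow> (\<forall>x. x \<notin> set_decode u)" for u by auto
  show ?case unfolding * by (intro arith_intros arith_comp[OF 0])
next
  case (Suc m)
  have *: "card (set_decode u) = Suc m \<longleftrightarrow>
    (\<exists>x v. (x \<in> set_decode u \<and> (\<forall>y. y \<in> set_decode v \<longleftrightarrow> y \<in> set_decode u \<and> y \<noteq> x)) \<and> card (set_decode v) = m)"
    (is "_ \<longleftrightarrow> ?R") for u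
  proof
    assume "card (set_decode u) = Suc m"
    moreover from this obtain x where "x \<in> set_decode u" by fastforce
    ultimately show ?R
      by (intro exI[of _ x] exI[of _ "set_encode (set_decode u - {x})"]) auto
  next
    assume ?R
    then obtain x v where "x \<in> set_decode u" "card (set_decode v) = m"
      "\<forall>y. y \<in> set_decode v \<longleftrightarrow> y \<in> set_decode u \<and> y \<noteq> x" by blast
    then have "set_decode u = insert x (set_decode v)" "x \<notin> set_decode v" by auto
    with \<open>card _ = m\<close> show "card (set_decode u) = Suc m" by simp
  qed
  show ?case unfolding *
    by (intro arith_ex arith_conj Suc.IH arith_all arith_iff) (intro arith_intros arith_comp[OF Suc.prems])+
qed

lemma arith_insert:
  assumes "af x" "af u"
  shows "af (\<lambda>z. set_encode (insert (x z) (set_decode (u z))))"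
proof (rule arith_set_encode)
  show "ap (\<lambda>z. psnd z \<in> insert (x (pfst z)) (set_decode (u (pfst z))))"
    unfolding insert_iff by (intro arith_intros arith_comp[OF assms(1)] arith_comp[OF assms(2)])
qed simp

lemma arith_infinite:
  assumes "ap (\<lambda>z. psnd z \<in> S (pfst z))"
  shows "ap (\<lambda>x. infinite (S x))"
  unfolding infinite_nat_iff_unbounded
  by (intro arith_intros arith_pred_comp2[OF assms, of "\<lambda>z. _ z" "\<lambda>z. _ z"])

text \<open>The colourings \<open>q n\<close> are stabilised one after another, each time by the
  least colour occurring infinitely often in the current reservoir. That reservoir is described by
  the finitely many choices made so far; their code is the state of an arithmetical
  recursion.\<close>

lemma arith_limit_colouring:
  assumes q: "af (\<lambda>z. q (pfst z) (psnd z))" and bounded: "\<And>s y. q s y < K"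
    and X: "ap (\<lambda>x. x \<in> X)" and "infinite X"
  obtains c where "af c" and "\<And>s. infinite {y \<in> X. \<forall>s'<s. q s' y = c s'}"
proof -
  define S where "S u = {y \<in> X. \<forall>p. p \<in> set_decode u \<longrightarrow> q (pfst p) y = psnd p}" for u
  \<comment> \<open>The default \<open>K\<close> makes the minimum exist for every \<open>u\<close>.
    At the states reached below, the pigeonhole principle yields a colour less than
    \<open>K\<close>, so the default is not taken.\<close>
  define next_colour where
    "next_colour n u = (LEAST c. c = K \<or> infinite {y \<in> S u. q n y = c})" for n u
  define state where
    "state = rec_nat 0 (\<lambda>n u. set_encode (insert (prod_encode (n, next_colour n u)) (set_decode u)))"
  have "af (\<lambda>z. next_colour (pfst z) (psnd z))"
    unfolding next_colour_def S_def
    by (rule arith_Least, intro arith_intros arith_infinite)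
      (unfold mem_Collect_eq, intro arith_intros arith_fun_comp2[OF q] arith_pred_comp[OF X], blast)
  note next_colour = arith_fun_comp2[OF this]
  have state: "af state"
    unfolding state_def by (intro arith_rec arith_insert next_colour arith_intros)
  have state_Suc: "set_decode (state (Suc n)) =
      insert (prod_encode (n, next_colour n (state n))) (set_decode (state n))" for n
    by (simp add: state_def)
  have inf: "infinite (S (state n))" for n
  proof (induction n)
    case 0
    show ?case using \<open>infinite X\<close> by (simp add: S_def state_def)
  next
    case (Suc n)
    have "\<exists>y0\<in>S (state n). infinite {y \<in> S (state n). q n y = q n y0}"
      using Suc by (rule pigeonhole_infinite)
        (rule finite_subset[of _ "{..<K}"], auto simp: bounded)
    then obtain y0 where y0: "q n y0 = K \<or> infinite {y \<in> S (state n). q n y = q n y0}" by blast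
    have "next_colour n (state n) = K \<or>
        infinite {y \<in> S (state n). q n y = next_colour n (state n)}"
      using LeastI[of "\<lambda>c. c = K \<or> infinite {y \<in> S (state n). q n y = c}", OF y0]
      unfolding next_colour_def .
    moreover have "next_colour n (state n) \<le> q n y0"
      using Least_le[of "\<lambda>c. c = K \<or> infinite {y \<in> S (state n). q n y = c}", OF y0]
      unfolding next_colour_def .
    ultimately have "infinite {y \<in> S (state n). q n y = next_colour n (state n)}"
      using bounded[of n y0] by auto
    moreover have "{y \<in> S (state n). q n y = next_colour n (state n)} \<subseteq> S (state (Suc n))"
      unfolding S_def state_Suc by auto
    ultimately show ?case using finite_subset by blast
  qed
  have mem: "s' < s \<Longrightarrow> prod_encode (s', next_colour s' (state s')) \<in> set_decode (state s)" for s' s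
    by (induction s) (auto simp: state_Suc less_Suc_eq)
  show thesis
  proof
    show "af (\<lambda>n. next_colour n (state n))" by (intro next_colour arith_id state)
    fix s
    have "S (state s) \<subseteq> {y \<in> X. \<forall>s'<s. q s' y = next_colour s' (state s')}"
      using mem[of _ s] unfolding S_def by fastforce
    with inf show "infinite {y \<in> X. \<forall>s'<s. q s' y = next_colour s' (state s')}"
      using finite_subset by blast
  qed
qed

text \<open>Induction on \<open>m\<close>. Once every finite set has a limit colour
  \<open>c\<close>, elements are chosen so that each, added to a set of earlier ones, already gives
  the limit colour. Then \<open>g (insert y T)\<close> depends on \<open>T\<close> alone, and the
  induction hypothesis applies to the colouring of \<open>T\<close> by
  \<open>c (set_encode T)\<close>.\<close>

lemma arith_ramsey:
  assumes "af (\<lambda>w. g (set_decode w))" and "\<And>S. g S < K"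
    and "ap (\<lambda>x. x \<in> X)" and "infinite X"
  shows "\<exists>Y c. ap (\<lambda>x. x \<in> Y) \<and> infinite Y \<and> Y \<subseteq> X \<and> (\<forall>S\<in>nsets Y m. g S = c)"
  using assms
proof (induction m arbitrary: g X)
  case 0
  then show ?case by (intro exI[of _ X] exI[of _ "g {}"]) (auto simp: nsets_def)
next
  case (Suc m)
  define q where "q s y = g (insert y (set_decode s))" for s y
  have g_eq: "q s y = g (set_decode (set_encode (insert y (set_decode s))))" for s y
    by (simp add: q_def)
  have "af (\<lambda>z. q (pfst z) (psnd z))"
    unfolding g_eq by (intro arith_comp[OF Suc.prems(1)] arith_insert arith_intros)
  note q = this arith_fun_comp2[OF this]
  have q_bounded: "q s y < K" for s y unfolding q_def by (rule Suc.prems)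
  obtain c where c: "af c" and inf: "\<And>s. infinite {y \<in> X. \<forall>s'<s. q s' y = c s'}"
    using arith_limit_colouring[OF q(1) q_bounded Suc.prems(3,4)] by blast
  have c_bounded: "c s < K" for s
  proof -
    have "{y \<in> X. \<forall>s'<Suc s. q s' y = c s'} \<noteq> {}" using inf[of "Suc s"] by (metis finite.emptyI)
    then obtain y where "q s y = c s" by blast
    with q_bounded[of s y] show ?thesis by simp
  qed
  \<comment> \<open>All finite sets up to \<open>b\<close> are considered, not only those of chosen
    elements. The condition thus depends on \<open>b\<close> alone, and the sequence is the
    iteration of a unary function.\<close>
  define good where "good b y \<longleftrightarrow> y \<in> X \<and> b < y \<and>
    (\<forall>s. (\<forall>x. x \<in> set_decode s \<longrightarrow> x \<le> b) \<longrightarrow> q s y = c s)" for b y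
  have ex_good: "\<exists>y. good b y" for b
  proof -
    \<comment> \<open>Finitely many codes \<open>s\<close> are concerned, so they lie below some
      \<open>n\<close>, and \<open>inf\<close> at \<open>n\<close> handles them together.\<close>
    have "{s. \<forall>x. x \<in> set_decode s \<longrightarrow> x \<le> b} \<subseteq> set_encode ` Pow {..b}"
      by (auto intro!: image_eqI[where x = "set_decode _"])
    then have "finite {s. \<forall>x. x \<in> set_decode s \<longrightarrow> x \<le> b}" by (rule finite_subset) simp
    then obtain n where n: "\<And>s. \<forall>x. x \<in> set_decode s \<longrightarrow> x \<le> b \<Longrightarrow> s < n"
      unfolding finite_nat_set_iff_bounded by auto
    from inf[of n] obtain y where "b < y" "y \<in> {y \<in> X. \<forall>s'<n. q s' y = c s'}"
      unfolding infinite_nat_iff_unbounded by blast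
    then have "good b y" unfolding good_def using n by auto
    then show ?thesis ..
  qed
  define step where "step b = (LEAST y. good b y)" for b
  have step: "good b (step b)" for b
    unfolding step_def using ex_good by (rule LeastI_ex)
  have "af step"
    unfolding step_def good_def
    by (rule arith_Least)
      (intro arith_intros arith_pred_comp[OF Suc.prems(3)] q(2) arith_comp[OF c],
       rule ex_good[unfolded good_def])
  note af_step = arith_comp[OF this]
  \<comment> \<open>Starting at \<open>step 0\<close> puts the first term in the range of
    \<open>step\<close> as well.\<close>
  define a where "a = rec_nat (step 0) (\<lambda>_. step)"
  have a_simps: "a 0 = step 0" "a (Suc n) = step (a n)" for n by (simp_all add: a_def)
  have "strict_mono a"
    using step unfolding strict_mono_Suc_iff a_simps good_def by blast
  define X' where "X' = range a"
  have "infinite X'"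
    unfolding X'_def using \<open>strict_mono a\<close> strict_mono_imp_inj_on range_inj_infinite by blast
  have "af a" unfolding a_def by (intro arith_rec af_step arith_intros)
  have "ap (\<lambda>x. x \<in> X')"
    unfolding X'_def image_iff bex_UNIV by (intro arith_intros arith_comp[OF \<open>af a\<close>])
  have "\<exists>b. y = step b \<and> (\<forall>x\<in>X'. x < y \<longrightarrow> x \<le> b)" if "y \<in> X'" for y
  proof -
    from that obtain n where n: "y = a n" unfolding X'_def by blast
    show ?thesis
    proof (cases n)
      case 0
      then show ?thesis
        using n \<open>strict_mono a\<close>
        by (intro exI[of _ 0]) (auto simp: X'_def a_simps(1)[symmetric] strict_mono_less)
    next
      case (Suc k)
      then show ?thesis using n \<open>strict_mono a\<close>
        by (intro exI[of _ "a k"]) (auto simp: X'_def a_simps strict_mono_less strict_mono_less_eq simp flip: a_simps(2))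
    qed
  qed
  then have prehom: "y \<in> X \<and> g (insert y T) = c (set_encode T)"
    if "y \<in> X'" "T \<subseteq> X'" "finite T" "\<And>x. x \<in> T \<Longrightarrow> x < y" for y T
  proof -
    from \<open>y \<in> X'\<close> obtain b where b: "y = step b" "\<forall>x\<in>X'. x < y \<longrightarrow> x \<le> b"
      using \<open>\<And>y. y \<in> X' \<Longrightarrow> _ y\<close> by blast
    with that have "\<forall>x. x \<in> set_decode (set_encode T) \<longrightarrow> x \<le> b" by auto
    then have "q (set_encode T) y = c (set_encode T)" "y \<in> X"
      using step[of b] b(1) unfolding good_def by blast+
    then show ?thesis using \<open>finite T\<close> by (simp add: q_def)
  qed
  from prehom have "X' \<subseteq> X" by (metis empty_iff empty_subsetI finite.emptyI subsetI)
  have "af (\<lambda>w. c (set_encode (set_decode w)))" using c by simp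
  from Suc.IH[of "\<lambda>S. c (set_encode S)", OF this c_bounded \<open>ap (\<lambda>x. x \<in> X')\<close> \<open>infinite X'\<close>]
  obtain Y d where Y: "ap (\<lambda>x. x \<in> Y)" "infinite Y" "Y \<subseteq> X'"
    "\<forall>S\<in>nsets Y m. c (set_encode S) = d" by blast
  have "g S = d" if "S \<in> nsets Y (Suc m)" for S
    using that
  proof (rule nsets_Suc_decompose)
    fix y T assume *: "S = insert y T" "y \<in> Y" "T \<in> nsets Y m" "\<And>x. x \<in> T \<Longrightarrow> x < y"
    then have "g S = c (set_encode T)"
      using prehom[of y T] Y(3) unfolding nsets_def by auto
    with Y(4) * show "g S = d" by simp
  qed
  with Y \<open>X' \<subseteq> X\<close> show ?case by blast
qed

lemma arith_ramsey_upto: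
  assumes g: "af (\<lambda>w. g (set_decode w))" "\<And>S. g S < K"
    and X: "ap (\<lambda>x. x \<in> X)" "infinite X"
  shows "\<exists>Y c. ap (\<lambda>x. x \<in> Y) \<and> infinite Y \<and> Y \<subseteq> X \<and> (\<forall>m<r. \<forall>S\<in>nsets Y m. g S = c m)"
proof (induction r)
  case 0
  show ?case using X by blast
next
  case (Suc r)
  then obtain Y c where Y: "ap (\<lambda>x. x \<in> Y)" "infinite Y" "Y \<subseteq> X"
    "\<forall>m<r. \<forall>S\<in>nsets Y m. g S = c m" by blast
  from arith_ramsey[OF g Y(1,2), of r] obtain Y' d where Y': "ap (\<lambda>x. x \<in> Y')" "infinite Y'" "Y' \<subseteq> Y"
    "\<forall>S\<in>nsets Y' r. g S = d" by blast
  have "\<forall>m<Suc r. \<forall>S\<in>nsets Y' m. g S = (c(r := d)) m"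
    using Y(4) Y'(4) nsets_mono[OF Y'(3)] by (simp add: less_Suc_eq) blast
  with Y Y' show ?case by blast
qed

end

section \<open>Homogeneous blocks for arbitrary colourings\<close>

text \<open>This is \<open>Max S\<close> for finite nonempty \<open>S\<close> and \<open>0\<close>
  for the empty set, in a form to which \<open>arith_Least\<close> applies.\<close>

definition least_bound :: "nat set \<Rightarrow> nat" where
  "least_bound S = (LEAST y. \<forall>x. x \<in> S \<longrightarrow> x \<le> y)"

lemma least_bound_insert: "(\<And>x. x \<in> T \<Longrightarrow> x < y) \<Longrightarrow> least_bound (insert y T) = y"
  unfolding least_bound_def by (rule Least_equality) (auto dest: less_imp_le)

context arithmetic_in
begin

text \<open>By contradiction. However complicated \<open>g\<close> is, a failure shows that for each
  \<open>N\<close> some finite colouring is bad. Badness is arithmetical, so the least bad codes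
  \<open>U N\<close> give an arithmetical colouring \<open>G\<close>, constant on each relevant size
  inside some \<open>Y\<close>. Density puts blocks \<open>E i\<close> into \<open>Y\<close>; with a
  point \<open>N\<close> of \<open>Y\<close> above them, \<open>G\<close> copies \<open>U N\<close>
  on their nonempty subsets of size at most \<open>n\<close>. So \<open>U N\<close> is homogeneous
  there, against badness.\<close>

lemma dense_imp_homogeneous:
  fixes g :: "nat set \<Rightarrow> nat"
  assumes X: "ap (\<lambda>x. x \<in> X)" "infinite X" and t: "finite t"
    and P: "\<And>i. i \<in> t \<Longrightarrow> ap (\<lambda>u. P i (set_decode u))"
    and dense: "\<And>Y i. ap (\<lambda>x. x \<in> Y) \<Longrightarrow> infinite Y \<Longrightarrow> Y \<subseteq> X \<Longrightarrow> i \<in> t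
      \<Longrightarrow> \<exists>E. finite E \<and> E \<subseteq> Y \<and> P i E"
    and g: "\<And>S. g S < K"
  shows "\<exists>j. \<forall>i\<in>t. \<exists>E. finite E \<and> E \<subseteq> X \<and> P i E \<and> (\<forall>m\<in>{1..n}. \<forall>S\<in>nsets E m. g S = j m)"
proof (rule ccontr)
  assume contra: "\<not> ?thesis"
  \<comment> \<open>\<open>u\<close> codes a finite colouring and \<open>v\<close> a vector of colours, indexed by the size of a set.  Colouring
    \<open>S\<close> by the bad colouring at stage \<open>Max S\<close> makes a separate compactness argument unnecessary.\<close>
  define bad where "bad N u \<longleftrightarrow> (\<forall>v. \<exists>i\<in>t. \<forall>e. (\<forall>x. x \<in> set_decode e \<longrightarrow> x \<in> X \<and> x < N)
    \<longrightarrow> P i (set_decode e) \<longrightarrow> (\<exists>w. (\<forall>x. x \<in> set_decode w \<longrightarrow> x \<in> set_decode e) \<and>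
      (\<exists>m\<in>{1..n}. card (set_decode w) = m \<and> colour_of K u w \<noteq> colour_of K v m)))" for N u
  have ex_bad: "\<exists>u. bad N u" for N
  proof -
    have "\<exists>u. \<forall>s\<in>set_encode ` Pow {..<N}. colour_of K u s = g (set_decode s)"
      using g by (intro ex_colour_of) (auto intro: less_imp_le)
    then obtain u where u: "\<forall>s\<in>set_encode ` Pow {..<N}. colour_of K u s = g (set_decode s)" ..
    have "bad N u"
      unfolding bad_def
    proof (rule allI)
      fix v
      \<comment> \<open>The negated claim is used for the vector whose entry at \<open>m\<close> is
        \<open>colour_of K v m\<close>.\<close>
      from contra obtain i where i: "i \<in> t" "\<not> (\<exists>E. finite E \<and> E \<subseteq> X \<and> P i E \<and>
          (\<forall>m\<in>{1..n}. \<forall>S\<in>nsets E m. g S = colour_of K v m))" by blast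
      have "\<exists>w. (\<forall>x. x \<in> set_decode w \<longrightarrow> x \<in> set_decode e) \<and>
          (\<exists>m\<in>{1..n}. card (set_decode w) = m \<and> colour_of K u w \<noteq> colour_of K v m)"
        if e: "\<forall>x. x \<in> set_decode e \<longrightarrow> x \<in> X \<and> x < N" "P i (set_decode e)" for e
      proof -
        have "\<not> (\<forall>m\<in>{1..n}. \<forall>S\<in>nsets (set_decode e) m. g S = colour_of K v m)"
          using i(2) e by (metis finite_set_decode subsetI)
        then obtain m S where S: "m \<in> {1..n}" "S \<in> nsets (set_decode e) m" "g S \<noteq> colour_of K v m"
          by blast
        then have "finite S" "S \<subseteq> {..<N}" "S \<subseteq> set_decode e" "card S = m"
          using e unfolding nsets_def by auto
        then have "colour_of K u (set_encode S) = g S" using u by simp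
        with S \<open>S \<subseteq> set_decode e\<close> \<open>card S = m\<close> \<open>finite S\<close> show ?thesis
          by (intro exI[of _ "set_encode S"]) auto
      qed
      with i(1) show "\<exists>i\<in>t. \<forall>e. (\<forall>x. x \<in> set_decode e \<longrightarrow> x \<in> X \<and> x < N)
    \<longrightarrow> P i (set_decode e) \<longrightarrow> (\<exists>w. (\<forall>x. x \<in> set_decode w \<longrightarrow> x \<in> set_decode e) \<and>
      (\<exists>m\<in>{1..n}. card (set_decode w) = m \<and> colour_of K u w \<noteq> colour_of K v m))" by blast
    qed
    then show ?thesis ..
  qed
  define U where "U N = (LEAST u. bad N u)" for N
  have U: "bad N (U N)" for N
    unfolding U_def using ex_bad by (rule LeastI_ex)
  have "af U"
    unfolding U_def bad_def
    by (rule arith_Least)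
      (intro arith_intros arith_bex_finite[OF t] arith_bex_finite[OF finite_atLeastAtMost]
        arith_pred_comp[OF P] arith_pred_comp[OF X(1)] arith_card, assumption?,
       use ex_bad[unfolded bad_def] in blast)
  have bound: "af (\<lambda>w. least_bound (set_decode w))"
    unfolding least_bound_def
  proof (rule arith_Least)
    show "\<exists>y. \<forall>z. z \<in> set_decode x \<longrightarrow> z \<le> y" for x
      using finite_nat_set_iff_bounded_le[THEN iffD1, OF finite_set_decode[of x]] by blast
  qed (intro arith_intros)
  define G where
    "G S = colour_of K (U (least_bound S)) (set_encode {x \<in> S. x \<noteq> least_bound S})" for S
  have "af (\<lambda>w. set_encode {x \<in> set_decode w. x \<noteq> least_bound (set_decode w)})"
    by (rule arith_set_encode) (simp, intro arith_intros arith_comp[OF bound], simp)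
  then have "af (\<lambda>w. G (set_decode w))"
    unfolding G_def by (intro arith_colour_of arith_comp[OF \<open>af U\<close>] bound)
  moreover have "G S < Suc K" for S
    unfolding G_def by (simp add: colour_of_le less_Suc_eq_le)
  \<comment> \<open>Sizes up to \<open>Suc n\<close> occur, since a subset of a block is enlarged by
    the point \<open>N\<close>.\<close>
  ultimately obtain Y c where Y: "ap (\<lambda>x. x \<in> Y)" "infinite Y" "Y \<subseteq> X"
      "\<And>m S. m < Suc (Suc n) \<Longrightarrow> S \<in> nsets Y m \<Longrightarrow> G S = c m"
    using arith_ramsey_upto[of G "Suc K" X "Suc (Suc n)"] X by blast
  \<comment> \<open>The minimum secures the bound asked for by \<open>ex_colour_of\<close>; the
    colours of \<open>G\<close> are at most \<open>K\<close>, so it changes nothing in the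
    comparison below.\<close>
  have "\<exists>v. \<forall>m\<in>{1..n}. colour_of K v m = min (c (Suc m)) K"
    by (rule ex_colour_of) simp_all
  then obtain v where v: "\<And>m. m \<in> {1..n} \<Longrightarrow> colour_of K v m = min (c (Suc m)) K"
    by blast
  from dense[OF Y(1-3)] obtain E where E: "\<And>i. i \<in> t \<Longrightarrow> finite (E i) \<and> E i \<subseteq> Y \<and> P i (E i)"
    by metis
  have "finite (\<Union>i\<in>t. E i)" using t E by blast
  then obtain b where b: "\<And>x i. i \<in> t \<Longrightarrow> x \<in> E i \<Longrightarrow> x < b"
    unfolding finite_nat_set_iff_bounded by blast
  obtain N where N: "N \<in> Y" "b < N"
    using Y(2) unfolding infinite_nat_iff_unbounded by blast
  from U[of N] obtain i where i: "i \<in> t" and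
    "\<forall>e. (\<forall>x. x \<in> set_decode e \<longrightarrow> x \<in> X \<and> x < N)
      \<longrightarrow> P i (set_decode e) \<longrightarrow> (\<exists>w. (\<forall>x. x \<in> set_decode w \<longrightarrow> x \<in> set_decode e) \<and>
      (\<exists>m\<in>{1..n}. card (set_decode w) = m \<and> colour_of K (U N) w \<noteq> colour_of K v m))"
    unfolding bad_def by blast
  from this(2)[rule_format, of "set_encode (E i)"] obtain w where
    w: "set_decode w \<subseteq> E i" "card (set_decode w) \<in> {1..n}"
      "colour_of K (U N) w \<noteq> colour_of K v (card (set_decode w))"
    using E[OF i] b[OF i] N(2) Y(3) by (auto simp: subset_iff dest: less_trans)
  have less: "x < N" if "x \<in> set_decode w" for x using that w(1) b[OF i] N(2) by fastforce
  then have "least_bound (insert N (set_decode w)) = N" by (rule least_bound_insert)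
  moreover from less have "{x \<in> insert N (set_decode w). x \<noteq> N} = set_decode w" by auto
  ultimately have "G (insert N (set_decode w)) = colour_of K (U N) w"
    unfolding G_def by simp
  moreover have "insert N (set_decode w) \<in> nsets Y (Suc (card (set_decode w)))"
    using less[of N] w(1) E[OF i] N(1) unfolding nsets_def by (auto simp: card_insert_if)
  ultimately have "colour_of K (U N) w = c (Suc (card (set_decode w)))"
    using Y(4)[of "Suc (card (set_decode w))"] w(2) by simp
  with w(2,3) v[of "card (set_decode w)"] colour_of_le[of K "U N" w] show False by simp
qed

end

text \<open>Tychonoff's theorem for finite discrete factors. A condition depends on the finitely
  many coordinates in \<open>\<Gamma>\<close> and is therefore closed; \<open>fin\<close> and
  \<open>mono\<close> give the finite intersection property. In the application the coordinates
  include all colourings, an uncountable family.\<close>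

lemma compact_choice_of_colours:
  fixes good :: "'g set \<Rightarrow> 'i \<Rightarrow> ('g \<Rightarrow> nat) \<Rightarrow> bool"
  assumes local: "\<And>\<Gamma> i J J'. (\<And>\<gamma>. \<gamma> \<in> \<Gamma> \<Longrightarrow> J \<gamma> = J' \<gamma>) \<Longrightarrow> good \<Gamma> i J \<Longrightarrow> good \<Gamma> i J'"
    and mono: "\<And>\<Gamma> \<Gamma>' i J. \<Gamma>' \<subseteq> \<Gamma> \<Longrightarrow> good \<Gamma> i J \<Longrightarrow> good \<Gamma>' i J"
    and fin: "\<And>\<Gamma> t. finite \<Gamma> \<Longrightarrow> finite t \<Longrightarrow> t \<subseteq> I
      \<Longrightarrow> \<exists>J. (\<forall>\<gamma>. J \<gamma> < k) \<and> (\<forall>i\<in>t. good \<Gamma> i J)"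
  shows "\<exists>J. (\<forall>\<gamma>. J \<gamma> < k) \<and> (\<forall>\<Gamma> i. finite \<Gamma> \<longrightarrow> i \<in> I \<longrightarrow> good \<Gamma> i J)"
proof -
  define T :: "('g \<Rightarrow> nat) topology" where
    "T = product_topology (\<lambda>_. discrete_topology {..<k}) UNIV"
  have topspace: "topspace T = {J. \<forall>\<gamma>. J \<gamma> < k}"
    by (auto simp: T_def PiE_def extensional_def)
  define C where "C \<Gamma> i = {J \<in> topspace T. good \<Gamma> i J}" for \<Gamma> i
  have "compact_space T"
    by (simp add: T_def compact_space_product_topology compact_space_discrete_topology)
  have closed: "closedin T (C \<Gamma> i)" if "finite \<Gamma>" for \<Gamma> i
  proof -
    define cyl where "cyl q = {J \<in> topspace T. \<forall>\<gamma>\<in>\<Gamma>. J \<gamma> = q \<gamma>}" for q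
    have cyl: "closedin T (cyl q)" for q
    proof -
      have "cyl q = topspace T \<inter> (\<Inter>\<gamma>\<in>\<Gamma>. {J \<in> topspace T. J \<gamma> \<in> {q \<gamma>} \<inter> {..<k}})"
        unfolding cyl_def topspace by auto
      moreover have "closedin T {J \<in> topspace T. J \<gamma> \<in> {q \<gamma>} \<inter> {..<k}}" for \<gamma>
        by (rule closedin_continuous_map_preimage[of T "discrete_topology {..<k}" "\<lambda>J. J \<gamma>"])
          (auto simp: T_def intro: continuous_map_product_projection)
      ultimately show ?thesis
        by (cases "\<Gamma> = {}") (auto intro!: closedin_Int closedin_Inter)
    qed
    \<comment> \<open>By \<open>local\<close> the condition is a union of cylinders over
      \<open>\<Gamma>\<close>, of which there are finitely many.\<close>
    have "C \<Gamma> i = \<Union> (cyl ` {q \<in> \<Gamma> \<rightarrow>\<^sub>E {..<k}. good \<Gamma> i q})"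
    proof (intro equalityI subsetI)
      fix J assume J: "J \<in> C \<Gamma> i"
      then have "good \<Gamma> i (restrict J \<Gamma>)"
        unfolding C_def by (auto intro: local[of \<Gamma> J])
      then show "J \<in> \<Union> (cyl ` {q \<in> \<Gamma> \<rightarrow>\<^sub>E {..<k}. good \<Gamma> i q})"
        using J by (intro UN_I[of "restrict J \<Gamma>"]) (auto simp: C_def cyl_def topspace)
    next
      fix J assume "J \<in> \<Union> (cyl ` {q \<in> \<Gamma> \<rightarrow>\<^sub>E {..<k}. good \<Gamma> i q})"
      then obtain q where "J \<in> topspace T" "\<And>\<gamma>. \<gamma> \<in> \<Gamma> \<Longrightarrow> q \<gamma> = J \<gamma>" "good \<Gamma> i q"
        unfolding cyl_def by fastforce
      then show "J \<in> C \<Gamma> i" unfolding C_def using local[of \<Gamma> q J] by blast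
    qed
    moreover have "finite {q \<in> \<Gamma> \<rightarrow>\<^sub>E {..<k}. good \<Gamma> i q}"
      using that finite_PiE[of \<Gamma> "\<lambda>_. {..<k}"] by simp
    ultimately show ?thesis
      using cyl by (auto intro!: closedin_Union)
  qed
  have "\<Inter> ({topspace T} \<union> {C \<Gamma> i |\<Gamma> i. finite \<Gamma> \<and> i \<in> I}) \<noteq> {}"
  proof (rule compact_space_fip[THEN iffD1, rule_format, OF \<open>compact_space T\<close>], intro conjI allI impI ballI)
    show "closedin T D" if "D \<in> {topspace T} \<union> {C \<Gamma> i |\<Gamma> i. finite \<Gamma> \<and> i \<in> I}" for D
      using that closed by auto
    fix F assume F: "finite F \<and> F \<subseteq> {topspace T} \<union> {C \<Gamma> i |\<Gamma> i. finite \<Gamma> \<and> i \<in> I}"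
    then have "\<forall>D\<in>F. \<exists>\<Gamma> t. finite \<Gamma> \<and> finite t \<and> t \<subseteq> I \<and> (\<forall>J\<in>topspace T. (\<forall>i\<in>t. good \<Gamma> i J) \<longrightarrow> J \<in> D)"
    proof (intro ballI)
      fix D assume "D \<in> F"
      with F consider "D = topspace T" | \<Gamma> i where "D = C \<Gamma> i" "finite \<Gamma>" "i \<in> I" by blast
      then show "\<exists>\<Gamma> t. finite \<Gamma> \<and> finite t \<and> t \<subseteq> I \<and> (\<forall>J\<in>topspace T. (\<forall>i\<in>t. good \<Gamma> i J) \<longrightarrow> J \<in> D)"
      proof cases
        case 1
        then show ?thesis by blast
      next
        case 2
        then show ?thesis by (intro exI[of _ \<Gamma>] exI[of _ "{i}"]) (auto simp: C_def)
      qed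
    qed
    then obtain \<Gamma> t where \<Gamma>t: "\<And>D. D \<in> F \<Longrightarrow> finite (\<Gamma> D) \<and> finite (t D) \<and> t D \<subseteq> I
        \<and> (\<forall>J\<in>topspace T. (\<forall>i\<in>t D. good (\<Gamma> D) i J) \<longrightarrow> J \<in> D)" by metis
    \<comment> \<open>All coordinates and indices of the finite subfamily are pooled;
      \<open>mono\<close> brings the result back to each member.\<close>
    have "\<exists>J. (\<forall>\<gamma>. J \<gamma> < k) \<and> (\<forall>i\<in>\<Union> (t ` F). good (\<Union> (\<Gamma> ` F)) i J)"
      using F \<Gamma>t by (intro fin) auto
    then obtain J where J: "J \<in> topspace T" "\<And>i. i \<in> \<Union> (t ` F) \<Longrightarrow> good (\<Union> (\<Gamma> ` F)) i J"
      unfolding topspace by blast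
    have "J \<in> D" if "D \<in> F" for D
      using \<Gamma>t[OF that] J that mono[of "\<Gamma> D" "\<Union> (\<Gamma> ` F)"] by blast
    then show "\<Inter> F \<noteq> {}" by blast
  qed
  then obtain J where "J \<in> topspace T" "\<And>\<Gamma> i. finite \<Gamma> \<Longrightarrow> i \<in> I \<Longrightarrow> J \<in> C \<Gamma> i" by blast
  then show ?thesis unfolding topspace C_def by blast
qed

type_synonym colouring = "nat set \<Rightarrow> nat"

text \<open>\<open>J (m, g)\<close> is the colour prescribed for the \<open>m\<close>-subsets of a block under the colouring \<open>g\<close>.\<close>

definition homogeneous_with ::
  "nat \<Rightarrow> nat \<Rightarrow> (nat \<times> colouring \<Rightarrow> nat) \<Rightarrow> (nat \<times> colouring) set \<Rightarrow> nat set \<Rightarrow> bool" where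
  "homogeneous_with n k J \<Gamma> E \<longleftrightarrow> (\<forall>m g S. (m, g) \<in> \<Gamma> \<longrightarrow> m \<in> {1..n} \<longrightarrow> (\<forall>S. g S < k)
     \<longrightarrow> S \<in> nsets E m \<longrightarrow> g S = J (m, g))"

context arithmetic_in
begin

text \<open>If some infinite arithmetical subset of the current reservoir contains no block
  satisfying \<open>P i\<close>, pass to it; otherwise the second alternative holds already. Both
  alternatives are inherited by subsets, so small numbers can be removed as well. Each reservoir is
  arithmetical; the sequence comes from dependent choice.\<close>

lemma deciding_reservoirs:
  obtains X where "\<And>s. ap (\<lambda>x. x \<in> X s)" "\<And>s. infinite (X s)" "decseq X" "\<And>s. X s \<subseteq> {s..}"
    "\<And>i. (\<forall>E. finite E \<longrightarrow> E \<subseteq> X (Suc i) \<longrightarrow> \<not> P i E) \<or>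
      (\<forall>Y. ap (\<lambda>x. x \<in> Y) \<longrightarrow> infinite Y \<longrightarrow> Y \<subseteq> X (Suc i) \<longrightarrow> (\<exists>E. finite E \<and> E \<subseteq> Y \<and> P i E))"
proof -
  define decided where "decided i X \<longleftrightarrow> (\<forall>E. finite E \<longrightarrow> E \<subseteq> X \<longrightarrow> \<not> P i E) \<or>
      (\<forall>Y. ap (\<lambda>x. x \<in> Y) \<longrightarrow> infinite Y \<longrightarrow> Y \<subseteq> X \<longrightarrow> (\<exists>E. finite E \<and> E \<subseteq> Y \<and> P i E))"
    for i X
  have decided_subset: "decided i X \<Longrightarrow> Y \<subseteq> X \<Longrightarrow> decided i Y" for i X Y
    unfolding decided_def by (meson subset_trans)
  have "\<exists>X. \<forall>s. (ap (\<lambda>x. x \<in> X s) \<and> infinite (X s) \<and> X s \<subseteq> {s..})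
      \<and> (X (Suc s) \<subseteq> X s \<and> decided s (X (Suc s)))"
  proof (rule dependent_nat_choice)
    show "\<exists>X. ap (\<lambda>x. x \<in> X) \<and> infinite X \<and> X \<subseteq> {0..}"
      by (intro exI[of _ UNIV]) (auto intro: arith_intros)
    fix X s assume X: "ap (\<lambda>x. x \<in> X) \<and> infinite X \<and> X \<subseteq> {s..}"
    have "\<exists>Y. ap (\<lambda>x. x \<in> Y) \<and> infinite Y \<and> Y \<subseteq> X \<and> decided s Y"
    proof (cases "\<exists>Y. ap (\<lambda>x. x \<in> Y) \<and> infinite Y \<and> Y \<subseteq> X \<and> (\<forall>E. finite E \<longrightarrow> E \<subseteq> Y \<longrightarrow> \<not> P s E)")
      case True
      then obtain Y where Y: "ap (\<lambda>x. x \<in> Y)" "infinite Y" "Y \<subseteq> X"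
        "\<forall>E. finite E \<longrightarrow> E \<subseteq> Y \<longrightarrow> \<not> P s E" by blast
      from Y(4) have "decided s Y" unfolding decided_def ..
      with Y show ?thesis by blast
    next
      case False
      then have "decided s X" unfolding decided_def by (intro disjI2) blast
      with X show ?thesis by blast
    qed
    then obtain Y where Y: "ap (\<lambda>x. x \<in> Y)" "infinite Y" "Y \<subseteq> X" "decided s Y" by blast
    have "ap (\<lambda>x. x \<in> Y \<inter> {Suc s..})"
      unfolding Int_iff atLeast_iff by (intro arith_intros Y(1))
    moreover have "infinite (Y \<inter> {Suc s..})"
    proof
      assume "finite (Y \<inter> {Suc s..})"
      then have "finite (Y \<inter> {Suc s..} \<union> {..s})" by simp
      then have "finite Y" by (rule rev_finite_subset) auto
      with Y(2) show False ..
    qed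
    ultimately show "\<exists>Y. (ap (\<lambda>x. x \<in> Y) \<and> infinite Y \<and> Y \<subseteq> {Suc s..}) \<and> (Y \<subseteq> X \<and> decided s Y)"
      using Y(3) decided_subset[OF Y(4)] by (intro exI[of _ "Y \<inter> {Suc s..}"]) blast
  qed
  then obtain X where X: "\<And>s. ap (\<lambda>x. x \<in> X s)" "\<And>s. infinite (X s)" "\<And>s. X s \<subseteq> {s..}"
    "\<And>s. X (Suc s) \<subseteq> X s" "\<And>s. decided s (X (Suc s))" by blast
  from X(4) have "decseq X" by (rule decseq_SucI)
  with X show thesis using that unfolding decided_def by blast
qed

text \<open>The point is the order of the quantifiers: one \<open>J\<close> serves all colourings,
  block types and reservoirs. Compactness leaves finitely many of each; the finitely many colourings
  are merged into a single one, whose colour vector \<open>j\<close> comes from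
  \<open>dense_imp_homogeneous\<close>.\<close>

lemma limit_colours:
  assumes P: "\<And>i. ap (\<lambda>u. P i (set_decode u))"
    and X: "\<And>s. ap (\<lambda>x. x \<in> X s)" "\<And>s. infinite (X s)" "decseq X"
    and dense: "\<And>i Y. i \<in> I \<Longrightarrow> ap (\<lambda>x. x \<in> Y) \<Longrightarrow> infinite Y \<Longrightarrow> Y \<subseteq> X (Suc i)
      \<Longrightarrow> \<exists>E. finite E \<and> E \<subseteq> Y \<and> P i E"
    and "0 < k"
  shows "\<exists>J. (\<forall>\<gamma>. J \<gamma> < k) \<and> (\<forall>\<Gamma> i s. finite \<Gamma> \<longrightarrow> i \<in> I \<longrightarrow>
    (\<exists>E. finite E \<and> E \<subseteq> X s \<and> P i E \<and> homogeneous_with n k J \<Gamma> E))"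
proof -
  define good where "good \<Gamma> r J \<longleftrightarrow>
    (\<exists>E. finite E \<and> E \<subseteq> X (snd r) \<and> P (fst r) E \<and> homogeneous_with n k J \<Gamma> E)"
    for \<Gamma> and r :: "nat \<times> nat" and J
  have "\<exists>J. (\<forall>\<gamma>. J \<gamma> < k) \<and> (\<forall>\<Gamma> r. finite \<Gamma> \<longrightarrow> r \<in> I \<times> UNIV \<longrightarrow> good \<Gamma> r J)"
  proof (rule compact_choice_of_colours)
    show "good \<Gamma> r J'" if "\<And>\<gamma>. \<gamma> \<in> \<Gamma> \<Longrightarrow> J \<gamma> = J' \<gamma>" "good \<Gamma> r J" for \<Gamma> r J J'
    proof -
      have "homogeneous_with n k J \<Gamma> E \<Longrightarrow> homogeneous_with n k J' \<Gamma> E" for E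
        using that(1) unfolding homogeneous_with_def by metis
      with that(2) show ?thesis unfolding good_def by blast
    qed
    show "good \<Gamma>' r J" if "\<Gamma>' \<subseteq> \<Gamma>" "good \<Gamma> r J" for \<Gamma> \<Gamma>' r J
    proof -
      have "homogeneous_with n k J \<Gamma> E \<Longrightarrow> homogeneous_with n k J \<Gamma>' E" for E
        using that(1) unfolding homogeneous_with_def by (meson subsetD)
      with that(2) show ?thesis unfolding good_def by blast
    qed
    fix \<Gamma> :: "(nat \<times> (nat set \<Rightarrow> nat)) set" and t :: "(nat \<times> nat) set"
    assume "finite \<Gamma>" "finite t" and t: "t \<subseteq> I \<times> UNIV"
    \<comment> \<open>\<open>homogeneous_with\<close> constrains colourings with values below
      \<open>k\<close> only, and for these the set of possible colour tuples is finite.\<close>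
    define \<Gamma>' where "\<Gamma>' = {\<gamma> \<in> \<Gamma>. \<forall>S. snd \<gamma> S < k}"
    have "finite (\<Gamma>' \<rightarrow>\<^sub>E {..<k})"
      unfolding \<Gamma>'_def using \<open>finite \<Gamma>\<close> by (intro finite_PiE) auto
    from finite_imp_inj_to_nat_seg[OF this] obtain \<phi> :: "(nat \<times> (nat set \<Rightarrow> nat) \<Rightarrow> nat) \<Rightarrow> nat" and K
      where \<phi>: "inj_on \<phi> (\<Gamma>' \<rightarrow>\<^sub>E {..<k})" "\<phi> ` (\<Gamma>' \<rightarrow>\<^sub>E {..<k}) = {i. i < K}"
      by (elim exE conjE)
    define h where "h S = restrict (\<lambda>\<gamma>. snd \<gamma> S) \<Gamma>'" for S
    have h: "h S \<in> \<Gamma>' \<rightarrow>\<^sub>E {..<k}" for S unfolding h_def \<Gamma>'_def by auto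
    \<comment> \<open>One \<open>s\<close> beyond all indices in \<open>t\<close>:
      \<open>X s\<close> lies in every reservoir concerned, and density holds below it.\<close>
    have "finite (fst ` t \<union> snd ` t)" using \<open>finite t\<close> by simp
    then obtain s where s: "\<And>x. x \<in> fst ` t \<union> snd ` t \<Longrightarrow> x < s"
      unfolding finite_nat_set_iff_bounded by blast
    have Xs: "X s \<subseteq> X (Suc i)" "X s \<subseteq> X s'" if "(i, s') \<in> t" for i s'
    proof -
      from that s[of i] s[of s'] have "Suc i \<le> s" "s' \<le> s" by force+
      with \<open>decseq X\<close> show "X s \<subseteq> X (Suc i)" "X s \<subseteq> X s'" by (auto dest: decseqD)
    qed
    have "\<exists>j. \<forall>i\<in>fst ` t. \<exists>E. finite E \<and> E \<subseteq> X s \<and> P i E \<and>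
        (\<forall>m\<in>{1..n}. \<forall>S\<in>nsets E m. \<phi> (h S) = j m)"
    proof (rule dense_imp_homogeneous)
      show "\<phi> (h S) < K" for S using \<phi>(2) h[of S] by blast
      show "\<exists>E. finite E \<and> E \<subseteq> Y \<and> P i E"
        if "ap (\<lambda>x. x \<in> Y)" "infinite Y" "Y \<subseteq> X s" "i \<in> fst ` t" for Y i
      proof -
        from that(4) obtain s' where "(i, s') \<in> t" by force
        with t Xs(1)[of i s'] that show ?thesis by (intro dense) auto
      qed
    qed (use X P \<open>finite t\<close> in auto)
    then obtain j where j: "\<And>i. i \<in> fst ` t \<Longrightarrow> \<exists>E. finite E \<and> E \<subseteq> X s \<and> P i E \<and>
        (\<forall>m\<in>{1..n}. \<forall>S\<in>nsets E m. \<phi> (h S) = j m)" by blast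
    \<comment> \<open>Any set whose merged colour is \<open>j m\<close> reveals the component for
      \<open>g\<close>, by injectivity of \<open>\<phi>\<close>. The default \<open>0\<close>
      respects the bound since \<open>0 < k\<close>.\<close>
    define J where "J \<gamma> = (if \<gamma> \<in> \<Gamma>' \<and> (\<exists>S. \<phi> (h S) = j (fst \<gamma>))
        then snd \<gamma> (SOME S. \<phi> (h S) = j (fst \<gamma>)) else 0)" for \<gamma>
    have J: "g S = J (m, g)" if "(m, g) \<in> \<Gamma>'" "\<phi> (h S) = j m" for m g S
    proof -
      let ?S = "SOME S. \<phi> (h S) = j m"
      from that(2) have "\<phi> (h ?S) = j m" by (rule someI)
      with that(2) \<phi>(1) h have "h ?S = h S" by (simp add: inj_on_def)
      then have "h ?S (m, g) = h S (m, g)" by simp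
      with that show ?thesis unfolding J_def h_def by auto
    qed
    have "J \<gamma> < k" for \<gamma> unfolding J_def \<Gamma>'_def using \<open>0 < k\<close> by auto
    moreover have "good \<Gamma> (i, s') J" if "(i, s') \<in> t" for i s'
    proof -
      from that j[of i] obtain E where E: "finite E" "E \<subseteq> X s" "P i E"
        "\<And>m S. m \<in> {1..n} \<Longrightarrow> S \<in> nsets E m \<Longrightarrow> \<phi> (h S) = j m" by force
      have "g S = J (m, g)" if "(m, g) \<in> \<Gamma>" "m \<in> {1..n}" "\<forall>S. g S < k" "S \<in> nsets E m" for m g S
        using that by (intro J E(4)) (auto simp: \<Gamma>'_def)
      then have "homogeneous_with n k J \<Gamma> E" unfolding homogeneous_with_def by blast
      moreover have "E \<subseteq> X s'" using E(2) Xs(2)[OF that] by blast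
      ultimately show ?thesis using E(1,3) unfolding good_def by (intro exI[of _ E]) simp
    qed
    ultimately show "\<exists>J. (\<forall>\<gamma>. J \<gamma> < k) \<and> (\<forall>r\<in>t. good \<Gamma> r J)"
      by (intro exI[of _ J]) (metis prod.exhaust)
  qed
  then show ?thesis unfolding good_def by simp
qed

end

section \<open>Colour types and limit colourings\<close>

text \<open>The colour prescribed for \<open>\<sigma>\<close> completed by \<open>l\<close> elements
  of a later block, seen as a colouring of \<open>\<sigma>\<close>.\<close>

definition limit_colouring :: "(nat \<times> colouring \<Rightarrow> nat) \<Rightarrow> nat \<Rightarrow> colouring \<Rightarrow> colouring" where
  "limit_colouring J l g = (\<lambda>\<sigma>. J (l, \<lambda>\<tau>. g (\<sigma> \<union> \<tau>)))"

text \<open>The union splits off the last block, which contributes \<open>Suc m - i\<close> elements.\<close>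

fun colours :: "(nat \<times> colouring \<Rightarrow> nat) \<Rightarrow> nat \<Rightarrow> colouring \<Rightarrow> nat set" where
  "colours J 0 g = {g {}}"
| "colours J (Suc m) g = (\<Union>i\<in>{..m}. colours J i (limit_colouring J (Suc m - i) g))"

text \<open>The colourings met while splitting off last blocks repeatedly, each with the size of the
  sets it still has to colour.\<close>

fun derived :: "(nat \<times> colouring \<Rightarrow> nat) \<Rightarrow> nat \<Rightarrow> colouring \<Rightarrow> (nat \<times> colouring) set" where
  "derived J 0 g = {(0, g)}"
| "derived J (Suc m) g =
    insert (Suc m, g) (\<Union>i\<in>{..m}. derived J i (limit_colouring J (Suc m - i) g))"

text \<open>The count of compositions: \<open>2 ^ (0 - 1)\<close> is \<open>1\<close>, so the sum is
  1 + 1 + 2 + ... + \<open>2 ^ (m - 1)\<close>, that is \<open>2 ^ m\<close>.\<close>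

lemma card_colours: "finite (colours J m g) \<and> card (colours J m g) \<le> 2 ^ (m - 1)"
proof (induction J m g rule: colours.induct)
  case (2 J m g)
  have "card (colours J (Suc m) g) \<le> (\<Sum>i\<le>m. card (colours J i (limit_colouring J (Suc m - i) g)))"
    unfolding colours.simps by (rule card_UN_le) simp
  also have "\<dots> \<le> (\<Sum>i\<le>m. 2 ^ (i - 1))"
    using 2 by (intro sum_mono) auto
  also have "\<dots> = 2 ^ m"
    by (induction m) (auto simp: power_eq_if)
  finally show ?case using 2 by auto
qed simp

lemma finite_derived: "finite (derived J m g)"
  by (induction J m g rule: derived.induct) auto

lemma derived_self: "(m, g) \<in> derived J m g"
  by (cases m) auto

lemma derived_limit:
  "(m', g') \<in> derived J m g \<Longrightarrow> l \<in> {1..m'} \<Longrightarrow> (m' - l, limit_colouring J l g') \<in> derived J m g"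
proof (induction J m g rule: derived.induct)
  case (2 J m g)
  show ?case
  proof (cases "(m', g') = (Suc m, g)")
    case True
    with 2(3) have *: "Suc m - l \<in> {..m}" "Suc m - (Suc m - l) = l" by auto
    have "(Suc m - l, limit_colouring J l g)
        \<in> (\<Union>i\<in>{..m}. derived J i (limit_colouring J (Suc m - i) g))"
      by (rule UN_I[OF * (1)]) (simp only: * (2) derived_self)
    with True show ?thesis by simp
  next
    case False
    with 2 show ?thesis by auto
  qed
qed simp

lemma derived_bounded:
  assumes "\<And>\<gamma>. J \<gamma> < k"
  shows "(m', g') \<in> derived J m g \<Longrightarrow> (\<And>S. g S < k) \<Longrightarrow> m' \<le> m \<and> g' S < k"
  using assms
  by (induction J m g rule: derived.induct) (fastforce simp: limit_colouring_def)+

lemma colours_limit: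
  assumes "l \<in> {1..m}"
  shows "colours J (m - l) (limit_colouring J l g) \<subseteq> colours J m g"
proof (cases m)
  case (Suc m')
  with assms have "Suc m' - l \<in> {..m'}" "Suc m' - (Suc m' - l) = l" by auto
  then have "colours J (Suc m' - l) (limit_colouring J l g) \<subseteq> colours J (Suc m') g"
    using UN_upper[of "Suc m' - l" "{..m'}" "\<lambda>i. colours J i (limit_colouring J (Suc m' - i) g)"]
    by (simp only: colours.simps)
  with Suc show ?thesis by simp
qed (use assms in simp)

text \<open>The invariant of the stems. It speaks of all derived colourings at once because
  splitting off a block passes from \<open>g\<close> to a limit colouring.\<close>

definition typed :: "(nat \<times> colouring \<Rightarrow> nat) \<Rightarrow> nat \<Rightarrow> colouring \<Rightarrow> nat set \<Rightarrow> bool" where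
  "typed J n f F \<longleftrightarrow> (\<forall>(m, g)\<in>derived J n f. \<forall>S\<in>nsets F m. g S \<in> colours J m g)"

lemma typed_empty: "typed J n f {}"
  unfolding typed_def
proof (intro ballI, clarify)
  fix m g and S :: "nat set" assume "(m, g) \<in> derived J n f" "S \<in> nsets {} m"
  then have "S = {}" "m = 0" unfolding nsets_def by auto
  then show "g S \<in> colours J m g" by simp
qed

text \<open>Homogeneity of the new block replaces \<open>g S\<close> by a limit colouring at the old
  part of \<open>S\<close>. That colouring is derived, for a smaller size, so the invariant for
  \<open>F\<close> gives its colour.\<close>

lemma typed_union:
  assumes "typed J n f F"
    and E: "\<And>m g l \<sigma> \<tau>. (m, g) \<in> derived J n f \<Longrightarrow> l \<in> {1..m} \<Longrightarrow> (\<sigma> :: nat set) \<subseteq> F \<Longrightarrow> \<tau> \<in> nsets E l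
      \<Longrightarrow> g (\<sigma> \<union> \<tau>) = J (l, \<lambda>\<tau>. g (\<sigma> \<union> \<tau>))"
  shows "typed J n f (F \<union> E)"
  unfolding typed_def
proof (intro ballI, clarify)
  fix m g S assume mg: "(m, g) \<in> derived J n f" and S: "S \<in> nsets (F \<union> E) m"
  \<comment> \<open>\<open>E\<close> may meet \<open>F\<close>; only the elements outside
    \<open>F\<close> count as new.\<close>
  define l where "l = card (S - F)"
  have fin: "finite S" and card: "card S = m" and sub: "S \<subseteq> F \<union> E" using S unfolding nsets_def by auto
  show "g S \<in> colours J m g"
  proof (cases "l = 0")
    case True
    then have "S \<subseteq> F" using fin unfolding l_def by auto
    then have "S \<in> nsets F m" using fin card unfolding nsets_def by auto
    with assms(1) mg show ?thesis unfolding typed_def by blast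
  next
    case False
    have S_eq: "S = (S \<inter> F) \<union> (S - F)" by blast
    have "card S = card (S \<inter> F) + l"
      unfolding l_def using fin by (metis card_Int_Diff)
    then have l: "l \<in> {1..m}" "card (S \<inter> F) = m - l" using card False by auto
    have "S - F \<in> nsets E l" using fin sub unfolding nsets_def l_def by auto
    from E[OF mg l(1) _ this, of "S \<inter> F"] have "g S = limit_colouring J l g (S \<inter> F)"
      using S_eq unfolding limit_colouring_def by simp
    moreover have "S \<inter> F \<in> nsets F (m - l)" using fin l(2) unfolding nsets_def by auto
    then have "limit_colouring J l g (S \<inter> F) \<in> colours J (m - l) (limit_colouring J l g)"
      using assms(1) derived_limit[OF mg l(1)] unfolding typed_def by blast
    ultimately show ?thesis using colours_limit[OF l(1)] by auto
  qed
qed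

section \<open>The forcing construction\<close>

lemma turing_join_iff:
  "w \<in> G \<oplus>\<^sub>T Z \<longleftrightarrow> (\<exists>h. w = h + h \<and> h \<in> G \<or> w = Suc (h + h) \<and> h \<in> Z)"
  unfolding turing_join_def by (auto simp: image_iff mult_2)

lemma agree_below_turing_join: "agree_below u G H \<Longrightarrow> agree_below u (G \<oplus>\<^sub>T Z) (H \<oplus>\<^sub>T Z)"
  unfolding agree_below_def turing_join_iff by fastforce

text \<open>A splitting: two subsets of the block lead to different values at one input, so at least
  one of them is wrong about any given \<open>A\<close>.\<close>

definition disagreement :: "nat set \<Rightarrow> recf \<Rightarrow> nat set \<Rightarrow> nat set \<Rightarrow> bool" where
  "disagreement Z p F E \<longleftrightarrow> (\<exists>E1 E2 x v1 v2. E1 \<subseteq> E \<and> E2 \<subseteq> E \<and> v1 \<noteq> v2 \<and>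
     computes ((F \<union> E1) \<oplus>\<^sub>T Z) p [x] v1 \<and> computes ((F \<union> E2) \<oplus>\<^sub>T Z) p [x] v2)"

lemma computes_join_finite_part:
  assumes "computes (G \<oplus>\<^sub>T Z) p xs y" and "F \<subseteq> G" and "G \<subseteq> F \<union> Y"
  shows "\<exists>E. finite E \<and> E \<subseteq> Y \<and> computes ((F \<union> E) \<oplus>\<^sub>T Z) p xs y"
proof -
  obtain u where u: "\<And>V. agree_below u V (G \<oplus>\<^sub>T Z) \<Longrightarrow> computes V p xs y"
    using computes_use[OF assms(1)] by blast
  have "agree_below u (F \<union> (G \<inter> Y \<inter> {..<u})) G"
    using assms(2,3) unfolding agree_below_def by auto
  then have "computes ((F \<union> (G \<inter> Y \<inter> {..<u})) \<oplus>\<^sub>T Z) p xs y"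
    by (intro u agree_below_turing_join)
  moreover have "finite (G \<inter> Y \<inter> {..<u})" by simp
  ultimately show ?thesis by blast
qed

context arithmetic_in
begin

lemma arith_computes_join:
  assumes F: "finite F" and "af c" "af x" "af y"
  shows "ap (\<lambda>z. computes ((F \<union> set_decode (c z)) \<oplus>\<^sub>T Z) p [x z] (y z))"
proof -
  have F': "w \<in> F \<longleftrightarrow> w \<in> set_decode (set_encode F)" for w using F by simp
  have "ap (\<lambda>z. pfst z \<in> (F \<union> set_decode (psnd z)) \<oplus>\<^sub>T Z)"
    unfolding turing_join_iff Un_iff F' by (intro arith_intros)
  then have "ap (\<lambda>z. computes ((F \<union> set_decode (c z)) \<oplus>\<^sub>T Z) p
      (list_decode (Suc (prod_encode (x z, 0)))) (y z))"
    by (rule arith_computes) (intro arith_intros assms)+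
  then show ?thesis by (simp add: list_decode_Suc_prod_encode)
qed

lemma arith_disagreement:
  assumes "finite F"
  shows "ap (\<lambda>u. disagreement Z p F (set_decode u))"
proof -
  have "disagreement Z p F (set_decode u) \<longleftrightarrow>
    (\<exists>e1 e2 x v1 v2. (\<forall>w. w \<in> set_decode e1 \<longrightarrow> w \<in> set_decode u) \<and>
      (\<forall>w. w \<in> set_decode e2 \<longrightarrow> w \<in> set_decode u) \<and> \<not> v1 = v2 \<and>
     computes ((F \<union> set_decode e1) \<oplus>\<^sub>T Z) p [x] v1 \<and>
     computes ((F \<union> set_decode e2) \<oplus>\<^sub>T Z) p [x] v2)" (is "_ \<longleftrightarrow> ?R") for u
  proof
    assume "disagreement Z p F (set_decode u)"
    then obtain E1 E2 x v1 v2 where E: "E1 \<subseteq> set_decode u" "E2 \<subseteq> set_decode u" "v1 \<noteq> v2"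
      "computes ((F \<union> E1) \<oplus>\<^sub>T Z) p [x] v1" "computes ((F \<union> E2) \<oplus>\<^sub>T Z) p [x] v2"
      unfolding disagreement_def by blast
    from E(1,2) have "finite E1" "finite E2" by (simp_all add: finite_subset[OF _ finite_set_decode])
    with E show ?R
      by (intro exI[of _ "set_encode E1"] exI[of _ "set_encode E2"] exI[of _ x] exI[of _ v1]
          exI[of _ v2]) auto
  next
    assume ?R
    then show "disagreement Z p F (set_decode u)" unfolding disagreement_def subset_iff by blast
  qed
  then show ?thesis
    by (simp only:) (intro arith_intros arith_computes_join assms)
qed

text \<open>If \<open>p\<close> never disagrees on finite subsets of the arithmetical reservoir \<open>Y\<close>, its values can be
  found by searching through these subsets, without knowing \<open>G\<close>.\<close>

lemma no_disagreement_imp_arith: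
  assumes "finite F" and Y: "ap (\<lambda>x. x \<in> Y)"
    and none: "\<And>E. finite E \<Longrightarrow> E \<subseteq> Y \<Longrightarrow> \<not> disagreement Z p F E"
    and G: "F \<subseteq> G" "G \<subseteq> F \<union> Y"
    and p: "\<And>x. computes (G \<oplus>\<^sub>T Z) p [x] (if x \<in> A then 1 else 0)"
  shows "ap (\<lambda>x. x \<in> A)"
proof -
  have "x \<in> A \<longleftrightarrow> (\<exists>e. (\<forall>w. w \<in> set_decode e \<longrightarrow> w \<in> Y) \<and>
      computes ((F \<union> set_decode e) \<oplus>\<^sub>T Z) p [x] 1)" (is "_ \<longleftrightarrow> ?R") for x
  proof -
    obtain E where E: "finite E" "E \<subseteq> Y"
      "computes ((F \<union> E) \<oplus>\<^sub>T Z) p [x] (if x \<in> A then 1 else 0)"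
      using computes_join_finite_part[OF p G] by blast
    show ?thesis
    proof
      assume "x \<in> A"
      with E show ?R by (intro exI[of _ "set_encode E"]) auto
    next
      assume ?R
      then obtain e where e: "set_decode e \<subseteq> Y" "computes ((F \<union> set_decode e) \<oplus>\<^sub>T Z) p [x] 1"
        by blast
      \<comment> \<open>The set \<open>E\<close> used by \<open>G\<close> and the set found by the
        search lie in one common block, so their values agree.\<close>
      have "\<not> disagreement Z p F (E \<union> set_decode e)" using E e by (intro none) auto
      then have "(if x \<in> A then 1 else 0) = (1 :: nat)"
        using E(3) e(2) unfolding disagreement_def by blast
      then show "x \<in> A" by (simp split: if_splits)
    qed
  qed
  moreover have "ap (\<lambda>x. \<exists>e. (\<forall>w. w \<in> set_decode e \<longrightarrow> w \<in> Y) \<and>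
      computes ((F \<union> set_decode e) \<oplus>\<^sub>T Z) p [x] 1)"
    by (intro arith_intros arith_computes_join arith_pred_comp[OF Y] \<open>finite F\<close>)
  ultimately show ?thesis by simp
qed

text \<open>Index \<open>0\<close> keeps the construction infinite; index \<open>Suc i\<close> codes a program and a finite set.\<close>

definition block_type :: "nat \<Rightarrow> nat set \<Rightarrow> bool" where
  "block_type i E \<longleftrightarrow> (case i of 0 \<Rightarrow> E \<noteq> {}
     | Suc r \<Rightarrow> \<exists>p. recf_encode p = pfst r \<and> disagreement Z p (set_decode (psnd r)) E)"

lemma arith_block_type: "ap (\<lambda>u. block_type i (set_decode u))"
proof (cases i)
  case 0
  have "E \<noteq> {} \<longleftrightarrow> (\<exists>x. x \<in> E)" for E :: "nat set" by blast
  then show ?thesis unfolding block_type_def 0 by (simp only: nat.case) (intro arith_intros)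
next
  case (Suc r)
  show ?thesis
  \<comment> \<open>The index \<open>r\<close> determines at most one program, which is fixed
    outside the formula.\<close>
  proof (cases "\<exists>p. recf_encode p = pfst r")
    case True
    then obtain p where p: "recf_encode p = pfst r" ..
    then have "(\<exists>q. recf_encode q = pfst r \<and> disagreement Z q F E) \<longleftrightarrow> disagreement Z p F E" for F E
      by (metis recf_encode_inj)
    then show ?thesis
      unfolding block_type_def Suc by (simp only: nat.case) (intro arith_disagreement finite_set_decode)
  next
    case False
    then show ?thesis unfolding block_type_def Suc by (auto intro: arith_pred_const)
  qed
qed

end

theorem theorem4p15:
  fixes n k :: nat and Z A :: "nat set" and f :: "nat set \<Rightarrow> nat"
  assumes "n \<ge> 1"
    and "\<not> arithmetical_in A Z"
    and "f \<in> nsets UNIV n \<rightarrow> {..<k}"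
  shows "\<exists>G :: nat set. infinite G \<and> card (f ` nsets G n) \<le> 2 ^ (n - 1) \<and> \<not> A \<le>\<^sub>T G \<oplus>\<^sub>T Z"
proof -
  interpret arithmetic_in Z .
  \<comment> \<open>A set that \<open>f\<close> colours, so there is at least one colour.\<close>
  have "{..<n} \<in> nsets UNIV n" unfolding nsets_def by simp
  with assms(3) have "0 < k" by fastforce
  \<comment> \<open>A colouring bounded on all sets; \<open>f\<close> is constrained on
    \<open>n\<close>-element sets only.\<close>
  define f' where "f' S = (if S \<in> nsets UNIV n then f S else 0)" for S
  have f': "f' S < k" for S
    using assms(3) \<open>0 < k\<close> unfolding f'_def by auto

  \<comment> \<open>Reservoirs and block colours\<close>
  obtain X where X: "\<And>s. ap (\<lambda>x. x \<in> X s)" "\<And>s. infinite (X s)" "decseq X" "\<And>s. X s \<subseteq> {s..}"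
    and decided: "\<And>i. (\<forall>E. finite E \<longrightarrow> E \<subseteq> X (Suc i) \<longrightarrow> \<not> block_type i E) \<or>
      (\<forall>Y. ap (\<lambda>x. x \<in> Y) \<longrightarrow> infinite Y \<longrightarrow> Y \<subseteq> X (Suc i) \<longrightarrow>
        (\<exists>E. finite E \<and> E \<subseteq> Y \<and> block_type i E))"
    using deciding_reservoirs[of block_type] by blast
  \<comment> \<open>The types for which the second alternative of \<open>decided\<close> holds, that
    is, those with blocks in every relevant set.\<close>
  define I where "I = {i. \<forall>Y. ap (\<lambda>x. x \<in> Y) \<longrightarrow> infinite Y \<longrightarrow> Y \<subseteq> X (Suc i) \<longrightarrow>
        (\<exists>E. finite E \<and> E \<subseteq> Y \<and> block_type i E)}"
  have "\<exists>J. (\<forall>\<gamma>. J \<gamma> < k) \<and> (\<forall>\<Gamma> i s. finite \<Gamma> \<longrightarrow> i \<in> I \<longrightarrow>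
      (\<exists>E. finite E \<and> E \<subseteq> X s \<and> block_type i E \<and> homogeneous_with n k J \<Gamma> E))"
    by (rule limit_colours[OF arith_block_type X(1-3) _ \<open>0 < k\<close>]) (simp add: I_def)
  then obtain J where J: "\<And>\<gamma>. J \<gamma> < k"
    and blocks: "\<And>\<Gamma> i s. finite \<Gamma> \<Longrightarrow> i \<in> I \<Longrightarrow>
      \<exists>E. finite E \<and> E \<subseteq> X s \<and> block_type i E \<and> homogeneous_with n k J \<Gamma> E" by blast

  \<comment> \<open>Extending a stem by one block\<close>
  have extend: "\<exists>E. finite E \<and> E \<subseteq> X b \<and> block_type i E \<and> (\<forall>E'\<subseteq>E. typed J n f' (F \<union> E'))"
    if "finite F" "typed J n f' F" "i \<in> I" for F i b
  proof -
    \<comment> \<open>The colourings that \<open>typed_union\<close> asks about; they are finitely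
      many because \<open>F\<close> is finite.\<close>
    define \<Gamma> where "\<Gamma> = (\<lambda>((m, g), l, \<sigma>). (l, \<lambda>\<tau>. g (\<sigma> \<union> \<tau>))) ` (derived J n f' \<times> {..n} \<times> Pow F)"
    have "finite \<Gamma>" unfolding \<Gamma>_def using finite_derived \<open>finite F\<close> by simp
    from blocks[OF this \<open>i \<in> I\<close>, of b] obtain E where E: "finite E" "E \<subseteq> X b" "block_type i E"
      "homogeneous_with n k J \<Gamma> E" by blast
    \<comment> \<open>All subsets of the block are covered, since which side of a disagreement is
      kept depends on \<open>A\<close>.\<close>
    have "typed J n f' (F \<union> E')" if "E' \<subseteq> E" for E'
    proof (rule typed_union[OF \<open>typed J n f' F\<close>])
      fix m g l \<sigma> \<tau>
      assume *: "(m, g) \<in> derived J n f'" "l \<in> {1..m}" "\<sigma> \<subseteq> F" "\<tau> \<in> nsets E' l"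
      have "m \<le> n" "\<And>S. g S < k" using derived_bounded[where J = J, OF J *(1)] f' by auto
      moreover from this have "(l, \<lambda>\<tau>. g (\<sigma> \<union> \<tau>)) \<in> \<Gamma>"
        unfolding \<Gamma>_def using * by (intro image_eqI[of _ _ "((m, g), l, \<sigma>)"]) auto
      moreover have "\<tau> \<in> nsets E l" using *(4) nsets_mono[OF that] by blast
      ultimately show "g (\<sigma> \<union> \<tau>) = J (l, \<lambda>\<tau>. g (\<sigma> \<union> \<tau>))"
        using E(4) *(2) unfolding homogeneous_with_def by simp
    qed
    with E show ?thesis by blast
  qed
  have "0 \<in> I" unfolding I_def block_type_def
  proof (simp, intro allI impI)
    fix Y :: "nat set" assume "infinite Y"
    then obtain y where "y \<in> Y" by fastforce
    then show "\<exists>E. finite E \<and> E \<subseteq> Y \<and> E \<noteq> {}" by (intro exI[of _ "{y}"]) auto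
  qed
  \<comment> \<open>The Mathias condition \<open>(F, X b)\<close> forces that no program with code
    \<open>e\<close> computes \<open>A\<close>.\<close>
  define avoids where "avoids e F b \<longleftrightarrow> (\<forall>G p. F \<subseteq> G \<longrightarrow> G \<subseteq> F \<union> X b \<longrightarrow> recf_encode p = e
    \<longrightarrow> \<not> (\<forall>x. computes (G \<oplus>\<^sub>T Z) p [x] (if x \<in> A then 1 else 0)))" for e F b
  have X_mono: "b \<le> b' \<Longrightarrow> X b' \<subseteq> X b" for b b' using \<open>decseq X\<close> by (auto dest: decseqD)

  \<comment> \<open>Defeating one program\<close>
  have avoid: "\<exists>F' b'. finite F' \<and> typed J n f' F' \<and> F \<subseteq> F' \<and> F' \<subseteq> F \<union> X b \<and> b \<le> b' \<and> avoids e F' b'"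
    if F: "finite F" "typed J n f' F" for F b e
  proof -
    \<comment> \<open>Disagreement depends on the stem, so the index codes program and stem
      together; the reservoirs have decided all such pairs beforehand.\<close>
    define i where "i = Suc (prod_encode (e, set_encode F))"
    have i: "block_type i E \<longleftrightarrow> (\<exists>p. recf_encode p = e \<and> disagreement Z p F E)" for E
      unfolding block_type_def i_def using F(1) by simp
    show ?thesis
    proof (cases "i \<in> I")
      case True
      from extend[OF F True, of b] obtain E where E: "finite E" "E \<subseteq> X b" "block_type i E"
        "\<And>E'. E' \<subseteq> E \<Longrightarrow> typed J n f' (F \<union> E')" by blast
      from E(3) obtain p E1 E2 x v1 v2 where p: "recf_encode p = e" and "E1 \<subseteq> E" "E2 \<subseteq> E"
        "v1 \<noteq> v2" "computes ((F \<union> E1) \<oplus>\<^sub>T Z) p [x] v1" "computes ((F \<union> E2) \<oplus>\<^sub>T Z) p [x] v2"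
        unfolding i disagreement_def by blast
      \<comment> \<open>Of two different values at most one is correct for \<open>A\<close>; the
        side giving a wrong one is kept.\<close>
      then obtain E' v where E': "E' \<subseteq> E" "v \<noteq> (if x \<in> A then 1 else 0)"
        "computes ((F \<union> E') \<oplus>\<^sub>T Z) p [x] v" by metis
      from computes_use[OF this(3)] obtain u where
        u: "\<And>V. agree_below u V ((F \<union> E') \<oplus>\<^sub>T Z) \<Longrightarrow> computes V p [x] v" by blast
      \<comment> \<open>Later elements are at least \<open>u\<close>, beyond the use of the wrong
        computation, which therefore survives.\<close>
      have "avoids e (F \<union> E') (max b u)"
        unfolding avoids_def
      proof (intro allI impI notI)
        fix G q assume G: "F \<union> E' \<subseteq> G" "G \<subseteq> F \<union> E' \<union> X (max b u)" and "recf_encode q = e"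
          and q: "\<forall>x. computes (G \<oplus>\<^sub>T Z) q [x] (if x \<in> A then 1 else 0)"
        then have "q = p" using p recf_encode_inj by blast
        have "agree_below u G (F \<union> E')"
          using G X(4)[of "max b u"] unfolding agree_below_def by fastforce
        then have "computes (G \<oplus>\<^sub>T Z) p [x] v" by (intro u agree_below_turing_join)
        with q \<open>q = p\<close> E'(2) show False by (metis computes_deterministic)
      qed
      with E E' F(1) show ?thesis
        by (intro exI[of _ "F \<union> E'"] exI[of _ "max b u"]) (auto dest: finite_subset)
    next
      case False
      with decided[of i] have none: "\<And>E. finite E \<Longrightarrow> E \<subseteq> X (Suc i) \<Longrightarrow> \<not> block_type i E"
        unfolding I_def by blast
      \<comment> \<open>Inside \<open>X (Suc i)\<close> no finite block disagrees, so a correct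
        computation of \<open>A\<close> would make \<open>A\<close> arithmetical.\<close>
      have "avoids e F (max b (Suc i))"
        unfolding avoids_def
      proof (intro allI impI notI)
        fix G p assume G: "F \<subseteq> G" "G \<subseteq> F \<union> X (max b (Suc i))" and p: "recf_encode p = e"
          and A: "\<forall>x. computes (G \<oplus>\<^sub>T Z) p [x] (if x \<in> A then 1 else 0)"
        have "\<not> disagreement Z p F E" if "finite E" "E \<subseteq> X (max b (Suc i))" for E
          using none[of E] that X_mono[of "Suc i" "max b (Suc i)"] p unfolding i by auto
        then have "ap (\<lambda>x. x \<in> A)"
          by (rule no_disagreement_imp_arith[OF F(1) X(1) _ G A[rule_format]])
        with assms(2) show False unfolding arithmetical_in_iff ..
      qed
      with F show ?thesis by (intro exI[of _ F] exI[of _ "max b (Suc i)"]) auto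
    qed
  qed

  \<comment> \<open>The sequence of conditions\<close>
  have step: "\<exists>F' b'. (finite F' \<and> typed J n f' F') \<and> F \<subseteq> F' \<and> F' \<subseteq> F \<union> X b \<and> b \<le> b' \<and> avoids e F' b'
      \<and> (\<exists>y\<in>F'. e \<le> y)"
    if F: "finite F" "typed J n f' F" for F b e
  proof -
    \<comment> \<open>A nonempty block from \<open>X (max b e)\<close> supplies an element at least
      \<open>e\<close>, which makes the limit infinite.\<close>
    from extend[OF F \<open>0 \<in> I\<close>, of "max b e"] obtain E where E: "finite E" "E \<subseteq> X (max b e)" "E \<noteq> {}"
      "typed J n f' (F \<union> E)" unfolding block_type_def by fastforce
    then obtain y where "y \<in> E" by blast
    with E(2) X(4)[of "max b e"] have y: "y \<in> F \<union> E" "e \<le> y" by auto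
    from avoid[of "F \<union> E" b e] E(1,4) F(1) obtain F' b' where F': "finite F'" "typed J n f' F'"
      "F \<union> E \<subseteq> F'" "F' \<subseteq> F \<union> E \<union> X b" "b \<le> b'" "avoids e F' b'" by blast
    moreover have "E \<subseteq> X b" using E(2) X_mono[of b "max b e"] by auto
    ultimately show ?thesis using y by (intro exI[of _ F'] exI[of _ b']) blast
  qed
  have "\<exists>c. \<forall>e. (finite (fst (c e)) \<and> typed J n f' (fst (c e))) \<and>
      (fst (c e) \<subseteq> fst (c (Suc e)) \<and> fst (c (Suc e)) \<subseteq> fst (c e) \<union> X (snd (c e)) \<and>
       snd (c e) \<le> snd (c (Suc e)) \<and> avoids e (fst (c (Suc e))) (snd (c (Suc e))) \<and>
       (\<exists>y\<in>fst (c (Suc e)). e \<le> y))"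
  proof (rule dependent_nat_choice)
    show "\<exists>c :: nat set \<times> nat. finite (fst c) \<and> typed J n f' (fst c)"
      by (rule exI[of _ "({}, 0)"]) (simp add: typed_empty)
  qed (use step in force)
  then obtain c where c: "\<And>e. finite (fst (c e))" "\<And>e. typed J n f' (fst (c e))"
    "\<And>e. fst (c e) \<subseteq> fst (c (Suc e))" "\<And>e. fst (c (Suc e)) \<subseteq> fst (c e) \<union> X (snd (c e))"
    "\<And>e. snd (c e) \<le> snd (c (Suc e))" "\<And>e. avoids e (fst (c (Suc e))) (snd (c (Suc e)))"
    "\<And>e. \<exists>y\<in>fst (c (Suc e)). e \<le> y" by blast

  \<comment> \<open>Properties of the limit set\<close>
  define G where "G = (\<Union>e. fst (c e))"
  have inc: "fst (c d) \<subseteq> fst (c e)" if "d \<le> e" for d e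
    using that c(3) by (rule lift_Suc_mono_le[rotated])
  \<comment> \<open>After stage \<open>e\<close> elements come from the reservoir of that stage
    alone, so \<open>G\<close> is among the sets over which \<open>avoids\<close>
    quantifies.\<close>
  have G_subset: "G \<subseteq> fst (c e) \<union> X (snd (c e))" for e
  proof -
    have "fst (c (e + d)) \<subseteq> fst (c e) \<union> X (snd (c e)) \<and> snd (c e) \<le> snd (c (e + d))" for d
    proof (induction d)
      case (Suc d)
      then have "X (snd (c (e + d))) \<subseteq> X (snd (c e))" by (intro X_mono) simp
      with Suc c(4)[of "e + d"] c(5)[of "e + d"] show ?case by auto
    qed simp
    moreover have "fst (c d) \<subseteq> fst (c (e + d))" for d by (rule inc) simp
    ultimately show ?thesis unfolding G_def by blast
  qed
  have "infinite G"
    unfolding infinite_nat_iff_unbounded_le using c(7) unfolding G_def by blast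
  moreover have "card (f ` nsets G n) \<le> 2 ^ (n - 1)"
  proof -
    have "f S \<in> colours J n f'" if S: "S \<in> nsets G n" for S
    proof -
      from S have "finite S" "S \<subseteq> G" "card S = n" unfolding nsets_def by auto
      have "\<exists>e. S \<subseteq> fst (c e)"
        using \<open>finite S\<close> \<open>S \<subseteq> G\<close>
      proof (induction S)
        case (insert x S)
        then obtain d e where "x \<in> fst (c d)" "S \<subseteq> fst (c e)" unfolding G_def by blast
        then show ?case
          using inc[of d "max d e"] inc[of e "max d e"] by (intro exI[of _ "max d e"]) auto
      qed simp
      then obtain e where "S \<in> nsets (fst (c e)) n"
        using \<open>finite S\<close> \<open>card S = n\<close> unfolding nsets_def by blast
      with c(2)[of e] derived_self[of n f' J] have "f' S \<in> colours J n f'"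
        unfolding typed_def by blast
      then show ?thesis
        using \<open>finite S\<close> \<open>card S = n\<close> unfolding f'_def nsets_def by simp
    qed
    then have "card (f ` nsets G n) \<le> card (colours J n f')"
      using card_colours by (intro card_mono) auto
    also have "\<dots> \<le> 2 ^ (n - 1)" using card_colours by blast
    finally show ?thesis .
  qed
  moreover have "\<not> A \<le>\<^sub>T G \<oplus>\<^sub>T Z"
  proof
    assume "A \<le>\<^sub>T G \<oplus>\<^sub>T Z"
    then obtain p where p: "\<forall>x. computes (G \<oplus>\<^sub>T Z) p [x] (if x \<in> A then 1 else 0)"
      unfolding turing_reducible_def by blast
    have "fst (c (Suc (recf_encode p))) \<subseteq> G" unfolding G_def by blast
    with c(6)[of "recf_encode p"] G_subset p show False unfolding avoids_def by blast
  qed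
  ultimately show ?thesis by blast
qed

end
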